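(* The group $G_{\mathcal N}$ is an amenable Lie group.
   Context: For $n\ge1$, $G_{\mathcal N}$ is the group of pairs $(V,\mathbf{m})$ with $V\in\mathbb{R}^{n\times n}$ upper triangular with positive diagonal and $\mathbf{m}\in\mathbb{R}^n$, with operation $(V_2,\mathbf{m}_2)\cdot(V_1,\mathbf{m}_1)=(V_2V_1,V_2\mathbf{m}_1+\mathbf{m}_2)$. A locally compact group is amenable if it admits a left-invariant averaging operation (left-invariant mean). *)

theory Defs
  imports "HOL-Analysis.Analysis" "HOL-Algebra.Group"
begin

section \<open>Smooth maps between open subsets of Euclidean spaces\<close>

text \<open>
  \<open>Ck_on k S f\<close> is only meant for open \<open>S\<close>: the derivatives are two-sided.
  For \<open>k \<ge> 1\<close> it asks for Frechet differentiability at every point of \<open>S\<close> together with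
  all directional derivatives \<open>x \<mapsto> Df(x) v\<close> being of class \<open>C\<^sup>k\<^sup>-\<^sup>1\<close>; as the domain is
  finite-dimensional this is the usual notion.
\<close>

primrec Ck_on :: "nat \<Rightarrow> 'a::euclidean_space set \<Rightarrow> ('a \<Rightarrow> 'b::euclidean_space) \<Rightarrow> bool" where
  "Ck_on 0 S f \<longleftrightarrow> continuous_on S f"
| "Ck_on (Suc k) S f \<longleftrightarrow>
     (\<forall>x\<in>S. f differentiable (at x)) \<and>
     (\<forall>v. Ck_on k S (\<lambda>x. frechet_derivative f (at x) v))"

definition smooth_on :: "'a::euclidean_space set \<Rightarrow> ('a \<Rightarrow> 'b::euclidean_space) \<Rightarrow> bool" where
  "smooth_on S f \<longleftrightarrow> open S \<and> (\<forall>k. Ck_on k S f)"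


section \<open>Smooth manifolds and Lie groups\<close>

text \<open>
  A chart is a pair \<open>(U, \<phi>)\<close>; only the values of \<open>\<phi>\<close> on \<open>U\<close> matter. An atlas is not required to
  be maximal, it determines the smooth structure it generates.
\<close>

type_synonym ('a, 'e) chart = "'a set \<times> ('a \<Rightarrow> 'e)"

definition smooth_atlas :: "'a topology \<Rightarrow> ('a, 'e::euclidean_space) chart set \<Rightarrow> bool" where
  "smooth_atlas X A \<longleftrightarrow>
     (\<forall>(U, \<phi>) \<in> A. openin X U \<and> open (\<phi> ` U) \<and>
        homeomorphic_map (subtopology X U) (top_of_set (\<phi> ` U)) \<phi>) \<and>
     (\<Union>(U, \<phi>) \<in> A. U) = topspace X \<and>
     (\<forall>(U, \<phi>) \<in> A. \<forall>(W, \<psi>) \<in> A. smooth_on (\<phi> ` (U \<inter> W)) (\<psi> \<circ> inv_into U \<phi>))"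

definition smooth_manifold :: "'a topology \<Rightarrow> ('a, 'e::euclidean_space) chart set \<Rightarrow> bool" where
  "smooth_manifold X A \<longleftrightarrow> Hausdorff_space X \<and> second_countable X \<and> smooth_atlas X A"

definition smooth_map ::
  "'a topology \<Rightarrow> ('a, 'e::euclidean_space) chart set \<Rightarrow>
   'b topology \<Rightarrow> ('b, 'f::euclidean_space) chart set \<Rightarrow> ('a \<Rightarrow> 'b) \<Rightarrow> bool" where
  "smooth_map X A Y B f \<longleftrightarrow> continuous_map X Y f \<and>
     (\<forall>(U, \<phi>) \<in> A. \<forall>(W, \<psi>) \<in> B.
        smooth_on (\<phi> ` (U \<inter> f -` W)) (\<psi> \<circ> f \<circ> inv_into U \<phi>))"

definition prod_atlas ::
  "('a, 'e) chart set \<Rightarrow> ('b, 'f) chart set \<Rightarrow> ('a \<times> 'b, 'e \<times> 'f) chart set" where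
  "prod_atlas A B = {(U \<times> W, map_prod \<phi> \<psi>) | U \<phi> W \<psi>. (U, \<phi>) \<in> A \<and> (W, \<psi>) \<in> B}"

definition lie_group ::
  "('a, 'm) monoid_scheme \<Rightarrow> 'a topology \<Rightarrow> ('a, 'e::euclidean_space) chart set \<Rightarrow> bool" where
  "lie_group G X A \<longleftrightarrow>
     group G \<and> topspace X = carrier G \<and> smooth_manifold X A \<and>
     smooth_map (prod_topology X X) (prod_atlas A A) X A (\<lambda>(x, y). x \<otimes>\<^bsub>G\<^esub> y) \<and>
     smooth_map X A X A (\<lambda>x. inv\<^bsub>G\<^esub> x)"


section \<open>Amenable locally compact groups\<close>

definition topological_group :: "('a, 'm) monoid_scheme \<Rightarrow> 'a topology \<Rightarrow> bool" where
  "topological_group G X \<longleftrightarrow>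
     group G \<and> topspace X = carrier G \<and>
     continuous_map (prod_topology X X) X (\<lambda>(x, y). x \<otimes>\<^bsub>G\<^esub> y) \<and>
     continuous_map X X (\<lambda>x. inv\<^bsub>G\<^esub> x)"

definition locally_compact_group :: "('a, 'm) monoid_scheme \<Rightarrow> 'a topology \<Rightarrow> bool" where
  "locally_compact_group G X \<longleftrightarrow>
     topological_group G X \<and> Hausdorff_space X \<and> locally_compact_space X"

text \<open>A left Haar measure: a nonzero left-invariant Radon measure on the Borel sets.\<close>

definition left_Haar_measure ::
  "('a, 'm) monoid_scheme \<Rightarrow> 'a topology \<Rightarrow> 'a measure \<Rightarrow> bool" where
  "left_Haar_measure G X \<mu> \<longleftrightarrow>
     space \<mu> = topspace X \<and>
     sets \<mu> = sigma_sets (topspace X) {U. openin X U} \<and>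
     emeasure \<mu> (topspace X) \<noteq> 0 \<and>
     (\<forall>K. compactin X K \<longrightarrow> emeasure \<mu> K < \<infinity>) \<and>
     (\<forall>B\<in>sets \<mu>. emeasure \<mu> B = (INF U\<in>{U. openin X U \<and> B \<subseteq> U}. emeasure \<mu> U)) \<and>
     (\<forall>U. openin X U \<longrightarrow> emeasure \<mu> U = (SUP K\<in>{K. compactin X K \<and> K \<subseteq> U}. emeasure \<mu> K)) \<and>
     (\<forall>g\<in>carrier G. \<forall>B\<in>sets \<mu>. emeasure \<mu> ((\<lambda>x. g \<otimes>\<^bsub>G\<^esub> x) ` B) = emeasure \<mu> B)"

text \<open>
  Properties holding locally almost everywhere. The exceptional set is null on every compact set,
  the usual convention for \<open>L\<^sup>\<infinity>\<close> of a locally compact group; on a \<open>\<sigma>\<close>-compact group this is the same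
  as holding almost everywhere.
\<close>

definition loc_AE :: "'a topology \<Rightarrow> 'a measure \<Rightarrow> ('a \<Rightarrow> bool) \<Rightarrow> bool" where
  "loc_AE X \<mu> P \<longleftrightarrow> (\<forall>K. compactin X K \<longrightarrow> (AE x in \<mu>. x \<in> K \<longrightarrow> P x))"

definition Linfty :: "'a topology \<Rightarrow> 'a measure \<Rightarrow> ('a \<Rightarrow> real) set" where
  "Linfty X \<mu> = {f \<in> borel_measurable \<mu>. \<exists>C. loc_AE X \<mu> (\<lambda>x. \<bar>f x\<bar> \<le> C)}"

text \<open>
  Means are functionals on representatives. Linearity and positivity with respect to \<open>loc_AE\<close> force
  them to agree on functions that are equal locally almost everywhere, so they are exactly the means
  on the quotient space \<open>L\<^sup>\<infinity>\<close>.
\<close>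

definition mean_on_Linfty :: "'a topology \<Rightarrow> 'a measure \<Rightarrow> (('a \<Rightarrow> real) \<Rightarrow> real) \<Rightarrow> bool" where
  "mean_on_Linfty X \<mu> M \<longleftrightarrow>
     (\<forall>f\<in>Linfty X \<mu>. \<forall>h\<in>Linfty X \<mu>. M (\<lambda>x. f x + h x) = M f + M h) \<and>
     (\<forall>c. \<forall>f\<in>Linfty X \<mu>. M (\<lambda>x. c * f x) = c * M f) \<and>
     (\<forall>f\<in>Linfty X \<mu>. loc_AE X \<mu> (\<lambda>x. 0 \<le> f x) \<longrightarrow> 0 \<le> M f) \<and>
     M (\<lambda>x. 1) = 1"

definition left_invariant_mean ::
  "('a, 'm) monoid_scheme \<Rightarrow> 'a topology \<Rightarrow> 'a measure \<Rightarrow> (('a \<Rightarrow> real) \<Rightarrow> real) \<Rightarrow> bool" where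
  "left_invariant_mean G X \<mu> M \<longleftrightarrow>
     mean_on_Linfty X \<mu> M \<and>
     (\<forall>g\<in>carrier G. \<forall>f\<in>Linfty X \<mu>. M (\<lambda>x. f (g \<otimes>\<^bsub>G\<^esub> x)) = M f)"

text \<open>
  The left Haar measure of a locally compact group exists and is unique up to a positive factor,
  and \<open>L\<^sup>\<infinity>\<close> does not depend on that factor, so the choice of \<open>\<mu>\<close> below is immaterial.
\<close>

definition amenable_group :: "('a, 'm) monoid_scheme \<Rightarrow> 'a topology \<Rightarrow> bool" where
  "amenable_group G X \<longleftrightarrow>
     locally_compact_group G X \<and>
     (\<exists>\<mu> M. left_Haar_measure G X \<mu> \<and> left_invariant_mean G X \<mu> M)"


section \<open>The group \<open>G\<^sub>\<N>\<close>\<close>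

text \<open>
  The index type \<open>'n\<close> is an arbitrary finite linear order, so \<open>n = CARD('n) \<ge> 1\<close>; its order is what
  upper triangular refers to. \<open>V $ i $ j\<close> is the entry in row \<open>i\<close> and column \<open>j\<close>.
\<close>

type_synonym 'n mat_vec = "((real, 'n) vec, 'n) vec \<times> (real, 'n) vec"

definition upper_triangular_pos :: "((real, 'n::{finite,linorder}) vec, 'n) vec \<Rightarrow> bool" where
  "upper_triangular_pos V \<longleftrightarrow> (\<forall>i j. j < i \<longrightarrow> V $ i $ j = 0) \<and> (\<forall>i. 0 < V $ i $ i)"

definition GN :: "'n::{finite,linorder} mat_vec monoid" where
  "GN = \<lparr> carrier = {(V, m). upper_triangular_pos V},
          mult = (\<lambda>(V2, m2) (V1, m1). (V2 ** V1, V2 *v m1 + m2)),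
          one = (mat 1, 0) \<rparr>"

definition GN_topology :: "'n::{finite,linorder} mat_vec topology" where
  "GN_topology = top_of_set (carrier GN)"

text \<open>
  The smooth structure is given by one global chart, the \<open>n(n+1)/2 + n\<close> free entries of \<open>(V, m)\<close>.
  The type \<open>'n upper_index\<close> indexes the entries on and above the diagonal.
\<close>

typedef (overloaded) 'n upper_index = "{(i::'n::linorder, j). i \<le> j}"
  by auto

instance upper_index :: ("{finite,linorder}") finite
proof
  have "range (Rep_upper_index :: 'a upper_index \<Rightarrow> 'a \<times> 'a) \<subseteq> UNIV"
    by simp
  then have "finite (range (Rep_upper_index :: 'a upper_index \<Rightarrow> 'a \<times> 'a))"
    by (rule finite_subset) simp
  then show "finite (UNIV :: 'a upper_index set)"
    by (rule finite_imageD) (simp add: inj_on_def Rep_upper_index_inject)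
qed

definition GN_chart ::
  "'n::{finite,linorder} mat_vec \<Rightarrow> (real, 'n upper_index) vec \<times> (real, 'n) vec" where
  "GN_chart = (\<lambda>(V, m). (\<chi> p. case Rep_upper_index p of (i, j) \<Rightarrow> V $ i $ j, m))"

definition GN_atlas ::
  "('n::{finite,linorder} mat_vec, (real, 'n upper_index) vec \<times> (real, 'n) vec) chart set" where
  "GN_atlas = {(carrier GN, GN_chart)}"

end

theory Submission
  imports Defs
begin

text \<open>
  In the chart given by the matrix entries the multiplication is polynomial and the inversion is
  rational, because the entries of the inverse of a triangular matrix are found by back substitution.
  Functions built from linear ones by sums, products and reciprocals are closed under directional
  derivatives, so all of them are smooth; this gives the Lie group structure.

  The group is amenable because it is solvable. Writing \<open>(V, m)\<close> as an upper triangular matrix with one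
  more column \<open>m\<close>, the elements whose entries at distance less than \<open>k\<close> from the diagonal are those of
  the identity form normal subgroups \<open>H\<^sub>0 \<supseteq> H\<^sub>1 \<supseteq> \<dots>\<close>, from the whole group down to the trivial one, and
  two elements of \<open>H\<^sub>k\<close> commute modulo \<open>H\<^sub>k\<^sub>+\<^sub>1\<close> (\<open>agree_commute\<close>). Starting from any mean on \<open>L\<^sup>\<infinity>\<close>, invariance is
  obtained for one \<open>H\<^sub>k\<close> after the other: the \<open>H\<^sub>k\<^sub>+\<^sub>1\<close>-invariant means form a nonempty compact convex set on which
  \<open>H\<^sub>k\<close> acts by commuting affine maps, and the Markov-Kakutani argument provides a fixed point
  (\<open>invariant_mean_extension\<close>). The argument takes place directly on \<open>L\<^sup>\<infinity>\<close>, so neither measurability nor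
  null sets interfere with the averaging.

  What remains is a left Haar measure. Factor an element as \<open>a n\<close> with \<open>a\<close> positive diagonal and \<open>n\<close>
  unipotent, and use the logarithms of the diagonal of \<open>a\<close> together with the entries of \<open>n\<close> as coordinates.
  They identify the group with a full Euclidean space, and left translations become maps that add to every
  coordinate a function of coordinates treated earlier. Such maps are compositions of shears and preserve
  Lebesgue measure (\<open>distr_lborel_triangular\<close>). Hence Lebesgue measure in these coordinates is a left Haar
  measure, and its regularity is that of Lebesgue measure.
\<close>

section \<open>Extending the invariance of means\<close>

text \<open>
  The function space and its positive cone are parameters: for \<open>L\<^sup>\<infinity>\<close> the cone consists of the functions that
  are nonnegative locally almost everywhere, not only of those that are nonnegative at every point.
\<close>

definition mean_on :: "('a \<Rightarrow> real) set \<Rightarrow> (('a \<Rightarrow> real) \<Rightarrow> bool) \<Rightarrow> (('a \<Rightarrow> real) \<Rightarrow> real) \<Rightarrow> bool" where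
  "mean_on V P M \<longleftrightarrow>
     (\<forall>f\<in>V. \<forall>h\<in>V. M (\<lambda>x. f x + h x) = M f + M h) \<and>
     (\<forall>c. \<forall>f\<in>V. M (\<lambda>x. c * f x) = c * M f) \<and>
     (\<forall>f\<in>V. P f \<longrightarrow> 0 \<le> M f) \<and>
     M (\<lambda>x. 1) = 1"

lemma
  assumes "mean_on V P M"
  shows mean_add: "f \<in> V \<Longrightarrow> h \<in> V \<Longrightarrow> M (\<lambda>x. f x + h x) = M f + M h"
    and mean_scale: "f \<in> V \<Longrightarrow> M (\<lambda>x. c * f x) = c * M f"
    and mean_nonneg: "f \<in> V \<Longrightarrow> P f \<Longrightarrow> 0 \<le> M f"
    and mean_one: "M (\<lambda>x. 1) = 1"
  using assms unfolding mean_on_def by blast+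

definition invariant_under :: "('a \<Rightarrow> real) set \<Rightarrow> ('a \<Rightarrow> 'a) set \<Rightarrow> (('a \<Rightarrow> real) \<Rightarrow> real) \<Rightarrow> bool" where
  "invariant_under V S M \<longleftrightarrow> (\<forall>s\<in>S. \<forall>f\<in>V. M (f \<circ> s) = M f)"

lemma comp_funpow_closed:
  assumes "\<And>f. Q f \<Longrightarrow> Q (f \<circ> s)" "Q f"
  shows "Q (f \<circ> s ^^ i)"
proof (induction i)
  case (Suc i)
  have "f \<circ> s ^^ Suc i = (f \<circ> s ^^ i) \<circ> s"
    by (simp only: funpow_Suc_right o_assoc)
  with assms(1)[OF Suc] show ?case by (simp only:)
qed (use assms in simp)

text \<open>
  The constant function \<open>1\<close> dominates every function of the space up to a factor. This bounds the values of
  all means at a given function, which is what makes the set of means compact.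
\<close>

locale order_unit_function_space =
  fixes V :: "('a \<Rightarrow> real) set" and P :: "('a \<Rightarrow> real) \<Rightarrow> bool"
  assumes one_in: "(\<lambda>x. 1) \<in> V"
    and add_in: "f \<in> V \<Longrightarrow> h \<in> V \<Longrightarrow> (\<lambda>x. f x + h x) \<in> V"
    and scale_in: "f \<in> V \<Longrightarrow> (\<lambda>x. c * f x) \<in> V"
    and bounded: "f \<in> V \<Longrightarrow> \<exists>C. P (\<lambda>x. C - f x) \<and> P (\<lambda>x. C + f x)"
begin

text \<open>
  The two-sided estimate \<open>- C \<le> f \<le> C\<close> in the order of the cone; it plays the part of a norm estimate.
\<close>

definition bound :: "('a \<Rightarrow> real) \<Rightarrow> real \<Rightarrow> bool" where
  "bound f C \<longleftrightarrow> P (\<lambda>x. C - f x) \<and> P (\<lambda>x. C + f x)"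

lemma mean_abs_le:
  assumes M: "mean_on V P M" and f: "f \<in> V" and C: "bound f C"
  shows "\<bar>M f\<bar> \<le> C"
proof -
  have c: "(\<lambda>x. C * 1) \<in> V" and mf: "(\<lambda>x. (-1) * f x) \<in> V"
    using scale_in one_in f by blast+
  have "M (\<lambda>x. C * 1) = C"
    using mean_scale[OF M one_in] mean_one[OF M] by simp
  moreover have "M (\<lambda>x. C * 1 + f x) = M (\<lambda>x. C * 1) + M f"
    by (rule mean_add[OF M c f])
  moreover have "M (\<lambda>x. C * 1 + (-1) * f x) = M (\<lambda>x. C * 1) + M (\<lambda>x. (-1) * f x)"
    by (rule mean_add[OF M c mf])
  moreover have "M (\<lambda>x. (-1) * f x) = (-1) * M f"
    by (rule mean_scale[OF M f])
  moreover have "P (\<lambda>x. C * 1 + f x)" "P (\<lambda>x. C * 1 + (-1) * f x)"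
    using C by (simp_all add: bound_def)
  then have "0 \<le> M (\<lambda>x. C * 1 + f x)" "0 \<le> M (\<lambda>x. C * 1 + (-1) * f x)"
    using mean_nonneg[OF M add_in[OF c f]] mean_nonneg[OF M add_in[OF c mf]] by blast+
  ultimately show ?thesis by simp
qed

lemma mean_average:
  assumes M: "mean_on V P M"
    and s: "\<And>f. f \<in> V \<Longrightarrow> f \<circ> s \<in> V" "\<And>f. P f \<Longrightarrow> P (f \<circ> s)" and N: "0 < (N::nat)"
  shows "mean_on V P (\<lambda>f. (\<Sum>i<N. M (f \<circ> s ^^ i)) / N)"
proof -
  have V: "f \<circ> s ^^ i \<in> V" if "f \<in> V" for f i
    using comp_funpow_closed[of "\<lambda>f. f \<in> V"] s(1) that by blast
  have P: "P (f \<circ> s ^^ i)" if "P f" for f i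
    using comp_funpow_closed[of P] s(2) that by blast
  show ?thesis
    unfolding mean_on_def
  proof (intro conjI ballI allI impI)
    fix f h assume "f \<in> V" "h \<in> V"
    then have "M ((\<lambda>x. f x + h x) \<circ> s ^^ i) = M (f \<circ> s ^^ i) + M (h \<circ> s ^^ i)" for i
      using mean_add[OF M V V] by (simp add: comp_def)
    then show "(\<Sum>i<N. M ((\<lambda>x. f x + h x) \<circ> s ^^ i)) / N =
        (\<Sum>i<N. M (f \<circ> s ^^ i)) / N + (\<Sum>i<N. M (h \<circ> s ^^ i)) / N"
      by (simp add: sum.distrib add_divide_distrib)
  next
    fix c f assume "f \<in> V"
    then have "M ((\<lambda>x. c * f x) \<circ> s ^^ i) = c * M (f \<circ> s ^^ i)" for i
      using mean_scale[OF M V] by (simp add: comp_def)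
    then show "(\<Sum>i<N. M ((\<lambda>x. c * f x) \<circ> s ^^ i)) / N = c * ((\<Sum>i<N. M (f \<circ> s ^^ i)) / N)"
      by (simp add: sum_distrib_left)
  next
    fix f assume "f \<in> V" "P f"
    then have "0 \<le> M (f \<circ> s ^^ i)" for i
      using mean_nonneg[OF M V P] by blast
    then show "0 \<le> (\<Sum>i<N. M (f \<circ> s ^^ i)) / N"
      by (simp add: sum_nonneg)
  next
    have "M ((\<lambda>x. 1) \<circ> s ^^ i) = 1" for i
      using mean_one[OF M] by (simp add: comp_def)
    then show "(\<Sum>i<N. M ((\<lambda>x. 1) \<circ> s ^^ i)) / N = 1"
      using N by simp
  qed
qed

text \<open>
  Averaging a mean over \<open>N + 1\<close> successive translates by \<open>t\<close> achieves this: in the difference of the values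
  at \<open>f\<close> and \<open>f \<circ> t\<close> all but the two extreme terms cancel.
\<close>

definition almost_invariant :: "('a \<Rightarrow> 'a) \<Rightarrow> nat \<Rightarrow> (('a \<Rightarrow> real) \<Rightarrow> real) \<Rightarrow> bool" where
  "almost_invariant t N M \<longleftrightarrow> (\<forall>f\<in>V. \<forall>C. bound f C \<longrightarrow> \<bar>M f - M (f \<circ> t)\<bar> \<le> 2 * C / Suc N)"

text \<open>
  The constraints are imposed one at a time. Averaging over powers of \<open>t\<close> gains the constraint for \<open>t\<close>.
  It keeps the invariance under \<open>S\<close> because powers of \<open>t\<close> can be moved past \<open>S\<close>, and it keeps the
  earlier constraints because the maps in \<open>T\<close> commute up to elements of \<open>S\<close>, which an \<open>S\<close>-invariant mean
  does not see.
\<close>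

lemma finitely_many_almost_invariant:
  assumes inv: "\<And>s f. s \<in> S \<union> T \<Longrightarrow> f \<in> V \<Longrightarrow> f \<circ> s \<in> V" "\<And>s f. s \<in> S \<union> T \<Longrightarrow> P f \<Longrightarrow> P (f \<circ> s)"
    and norm: "\<And>s t. s \<in> S \<Longrightarrow> t \<in> T \<Longrightarrow> \<exists>s'\<in>S. s \<circ> t = t \<circ> s'"
    and comm: "\<And>t t'. t \<in> T \<Longrightarrow> t' \<in> T \<Longrightarrow> \<exists>s\<in>S. t \<circ> t' = t' \<circ> t \<circ> s"
    and M0: "mean_on V P M0" "invariant_under V S M0"
    and F: "finite F" "F \<subseteq> T \<times> UNIV"
  shows "\<exists>M. mean_on V P M \<and> invariant_under V S M \<and> (\<forall>(t, N)\<in>F. almost_invariant t N M)"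
  using F
proof (induction F)
  case empty
  then show ?case using M0 by auto
next
  case (insert tN F)
  obtain t K where tK: "tN = (t, K)" by fastforce
  with insert.prems have t: "t \<in> T" by auto
  obtain M where M: "mean_on V P M" "invariant_under V S M"
      and ai: "\<forall>(t, N)\<in>F. almost_invariant t N M"
    using insert by blast
  define N where "N = Suc K"
  define M' where "M' = (\<lambda>f. (\<Sum>i<N. M (f \<circ> t ^^ i)) / N)"
  have tV: "f \<circ> t \<in> V" if "f \<in> V" for f using inv t that by blast
  have V: "f \<circ> t ^^ i \<in> V" if "f \<in> V" for f i
    using comp_funpow_closed[of "\<lambda>f. f \<in> V"] tV that by blast
  have P: "P (f \<circ> t ^^ i)" if "P f" for f i
    using comp_funpow_closed[of P] inv(2) t that by blast
  have bound_pow: "bound (f \<circ> t ^^ i) C" if "bound f C" for f i C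
    using that P[of "\<lambda>x. C - f x" i] P[of "\<lambda>x. C + f x" i] by (simp add: bound_def comp_def)
  have pass: "\<exists>s'\<in>S. s \<circ> t ^^ i = t ^^ i \<circ> s'" if "s \<in> S" for s i
  proof (induction i)
    case 0
    then show ?case using that by auto
  next
    case (Suc i)
    then obtain s' where s': "s' \<in> S" "s \<circ> t ^^ i = t ^^ i \<circ> s'" by blast
    obtain s'' where s'': "s'' \<in> S" "s' \<circ> t = t \<circ> s''" using norm s'(1) t by blast
    have "s \<circ> t ^^ Suc i = (s \<circ> t ^^ i) \<circ> t"
      by (simp add: funpow_Suc_right comp_assoc del: funpow.simps(2))
    also have "\<dots> = t ^^ Suc i \<circ> s''"
      using s' s'' by (simp add: funpow_Suc_right comp_assoc del: funpow.simps(2))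
    finally show ?case using s'' by blast
  qed
  have MS: "M (f \<circ> s) = M f" if "s \<in> S" "f \<in> V" for s f
    using M(2) that by (auto simp: invariant_under_def)
  have swap: "M (f \<circ> u \<circ> t ^^ i) = M (f \<circ> t ^^ i \<circ> u)" if u: "u \<in> T" and f: "f \<in> V" for u f i
    using f
  proof (induction i arbitrary: f)
    case 0
    then show ?case by simp
  next
    case (Suc i)
    obtain s where s: "s \<in> S" "u \<circ> t = t \<circ> u \<circ> s" using comm u t by blast
    obtain s' where s': "s' \<in> S" "s \<circ> t ^^ i = t ^^ i \<circ> s'" using pass s by blast
    have fV: "f \<circ> t \<circ> u \<circ> t ^^ i \<in> V"
      using inv u V tV Suc.prems by blast
    have "f \<circ> u \<circ> t ^^ Suc i = f \<circ> (u \<circ> t) \<circ> t ^^ i"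
      by (simp add: funpow_swap1 fun_eq_iff)
    also have "\<dots> = f \<circ> t \<circ> u \<circ> (s \<circ> t ^^ i)"
      by (simp add: s(2) comp_assoc)
    also have "\<dots> = (f \<circ> t \<circ> u \<circ> t ^^ i) \<circ> s'"
      by (simp add: s' comp_assoc)
    finally have "M (f \<circ> u \<circ> t ^^ Suc i) = M ((f \<circ> t) \<circ> u \<circ> t ^^ i)"
      using MS[OF s'(1) fV] by simp
    also have "\<dots> = M ((f \<circ> t) \<circ> t ^^ i \<circ> u)"
      using Suc.IH[OF tV[OF Suc.prems]] .
    also have "(f \<circ> t) \<circ> t ^^ i = f \<circ> t ^^ Suc i"
      by (simp add: comp_assoc)
    finally show ?case .
  qed
  have "mean_on V P M'"
    unfolding M'_def by (rule mean_average) (use M inv t in \<open>auto simp: N_def\<close>)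
  moreover have "invariant_under V S M'"
    unfolding invariant_under_def
  proof (intro ballI)
    fix s f assume s: "s \<in> S" and f: "f \<in> V"
    have "M (f \<circ> s \<circ> t ^^ i) = M (f \<circ> t ^^ i)" for i
    proof -
      obtain s' where s': "s' \<in> S" "s \<circ> t ^^ i = t ^^ i \<circ> s'" using pass s by blast
      then have "f \<circ> s \<circ> t ^^ i = (f \<circ> t ^^ i) \<circ> s'" by (simp add: comp_assoc)
      then show ?thesis using MS[OF s'(1) V[OF f, of i]] by simp
    qed
    then show "M' (f \<circ> s) = M' f" by (simp add: M'_def)
  qed
  moreover have "almost_invariant u L M'" if "(u, L) \<in> insert tN F" for u L
    unfolding almost_invariant_def
  proof (intro ballI allI impI)
    fix f C assume f: "f \<in> V" and C: "bound f C"
    from that consider "u = t" "L = K" | "(u, L) \<in> F" using tK by blast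
    then show "\<bar>M' f - M' (f \<circ> u)\<bar> \<le> 2 * C / real (Suc L)"
    proof cases
      case 1
      have "(\<Sum>i<N. M (f \<circ> t ^^ i)) - (\<Sum>i<N. M (f \<circ> t ^^ Suc i)) = M f - M (f \<circ> t ^^ N)"
        using sum_lessThan_telescope'[of "\<lambda>i. M (f \<circ> t ^^ i)" N]
        by (simp add: sum_subtractf)
      moreover have "f \<circ> t \<circ> t ^^ i = f \<circ> t ^^ Suc i" for i
        by (simp add: comp_assoc)
      ultimately have "M' f - M' (f \<circ> u) = (M f - M (f \<circ> t ^^ N)) / N"
        by (simp add: M'_def 1 flip: diff_divide_distrib)
      moreover have "\<bar>M f\<bar> \<le> C" "\<bar>M (f \<circ> t ^^ N)\<bar> \<le> C"
        using mean_abs_le[OF M(1)] f V C bound_pow by blast+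
      ultimately show ?thesis
        using 1 by (simp add: N_def divide_right_mono)
    next
      case 2
      then have u: "u \<in> T" using insert.prems by auto
      have "\<bar>M (f \<circ> t ^^ i) - M (f \<circ> u \<circ> t ^^ i)\<bar> \<le> 2 * C / Suc L" for i
        using ai 2 V[OF f, of i] bound_pow[OF C, of i] swap[OF u f, of i]
        by (auto simp: almost_invariant_def)
      then have "\<bar>\<Sum>i<N. M (f \<circ> t ^^ i) - M (f \<circ> u \<circ> t ^^ i)\<bar> \<le> (\<Sum>i<N. 2 * C / Suc L)"
        by (intro sum_abs[THEN order_trans] sum_mono)
      then have "\<bar>\<Sum>i<N. M (f \<circ> t ^^ i) - M (f \<circ> u \<circ> t ^^ i)\<bar> / N \<le> 2 * C / Suc L"
        by (simp add: N_def divide_simps mult.commute)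
      moreover have "M' f - M' (f \<circ> u) = (\<Sum>i<N. M (f \<circ> t ^^ i) - M (f \<circ> u \<circ> t ^^ i)) / N"
        by (simp add: M'_def sum_subtractf diff_divide_distrib)
      ultimately show ?thesis by (simp add: N_def)
    qed
  qed
  ultimately show ?case by blast
qed

text \<open>
  The Markov-Kakutani fixed point argument. By Tychonoff's theorem the means form a compact set in the
  product topology. The conditions of being almost invariant are closed, and any finitely many of them can
  be met by a mean invariant under \<open>S\<close>, hence so can all of them at once, which is exact invariance.
\<close>

theorem invariant_mean_extension:
  assumes inv: "\<And>s f. s \<in> S \<union> T \<Longrightarrow> f \<in> V \<Longrightarrow> f \<circ> s \<in> V" "\<And>s f. s \<in> S \<union> T \<Longrightarrow> P f \<Longrightarrow> P (f \<circ> s)"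
    and norm: "\<And>s t. s \<in> S \<Longrightarrow> t \<in> T \<Longrightarrow> \<exists>s'\<in>S. s \<circ> t = t \<circ> s'"
    and comm: "\<And>t t'. t \<in> T \<Longrightarrow> t' \<in> T \<Longrightarrow> \<exists>s\<in>S. t \<circ> t' = t' \<circ> t \<circ> s"
    and M0: "mean_on V P M0" "invariant_under V S M0"
  shows "\<exists>M. mean_on V P M \<and> invariant_under V (S \<union> T) M"
proof -
  obtain c where c: "\<And>f. f \<in> V \<Longrightarrow> bound f (c f)"
    using bounded unfolding bound_def by metis
  \<comment> \<open>A functional carries arbitrary values off \<open>V\<close>; setting them to \<open>0\<close> confines it to a compact box.\<close>
  define Q where "Q = (\<Pi>\<^sub>E f\<in>UNIV. if f \<in> V then {- c f..c f} else {0})"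
  have "compactin (product_topology (\<lambda>_. euclidean) UNIV) Q"
    unfolding Q_def compactin_PiE by auto
  then have Q: "compact Q"
    by (simp add: euclidean_product_topology)
  have ev [continuous_intros]: "continuous_on UNIV (\<lambda>M::('a \<Rightarrow> real) \<Rightarrow> real. M f)" for f
    by (rule continuous_on_product_coordinates)
  have cl_mean: "closed {M. mean_on V P M}"
    unfolding mean_on_def Ball_def
    by (intro closed_Collect_conj closed_Collect_all closed_Collect_imp
        closed_Collect_eq closed_Collect_le continuous_intros open_Collect_const)
  have cl_inv: "closed {M. invariant_under V S M}"
    unfolding invariant_under_def Ball_def
    by (intro closed_Collect_all closed_Collect_imp closed_Collect_eq continuous_intros
        open_Collect_const)
  have cl_ai: "closed {M. almost_invariant t N M}" for t N
    unfolding almost_invariant_def Ball_def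
    by (intro closed_Collect_all closed_Collect_imp closed_Collect_le
        continuous_intros open_Collect_const)
  define K where "K = Q \<inter> ({M. mean_on V P M} \<inter> {M. invariant_under V S M})"
  have "K \<inter> (\<Inter>(t, N)\<in>T \<times> UNIV. {M. almost_invariant t N M}) \<noteq> {}"
  proof (rule compact_imp_fip_image)
    show "compact K"
      unfolding K_def using Q cl_mean cl_inv by (intro compact_Int_closed closed_Int)
    show "closed (case i of (t, N) \<Rightarrow> {M. almost_invariant t N M})" for i
      using cl_ai by (cases i) simp
  next
    fix F :: "(('a \<Rightarrow> 'a) \<times> nat) set" assume F: "finite F" "F \<subseteq> T \<times> UNIV"
    obtain M where M: "mean_on V P M" "invariant_under V S M" "\<forall>(t, N)\<in>F. almost_invariant t N M"
      using finitely_many_almost_invariant[OF inv norm comm M0 F] by blast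
    define M' where "M' = (\<lambda>f. if f \<in> V then M f else 0)"
    have "M' \<in> Q"
      using mean_abs_le[OF M(1) _ c] by (auto simp: Q_def M'_def abs_le_iff)
         (metis minus_le_iff)
    moreover have "mean_on V P M'"
      using M(1) add_in scale_in one_in by (auto simp: mean_on_def M'_def)
    moreover have "invariant_under V S M'"
      using M(2) inv by (auto simp: invariant_under_def M'_def)
    moreover have "\<forall>(t, N)\<in>F. almost_invariant t N M'"
    proof safe
      fix t N assume tN: "(t, N) \<in> F"
      with F have "t \<in> T" by auto
      then show "almost_invariant t N M'"
        using M(3) tN inv by (force simp: almost_invariant_def M'_def)
    qed
    ultimately have "M' \<in> K \<inter> (\<Inter>(t, N)\<in>F. {M. almost_invariant t N M})"
      by (auto simp: K_def)
    then show "K \<inter> (\<Inter>(t, N)\<in>F. {M. almost_invariant t N M}) \<noteq> {}" by blast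
  qed
  then obtain M where M: "mean_on V P M" "invariant_under V S M"
      and ai: "\<And>t N. t \<in> T \<Longrightarrow> almost_invariant t N M"
    by (force simp: K_def)
  have "M (f \<circ> t) = M f" if "t \<in> T" "f \<in> V" for t f
  proof -
    have "\<bar>M f - M (f \<circ> t)\<bar> \<le> 2 * c f / Suc N" for N
      using ai[OF that(1)] that(2) c by (auto simp: almost_invariant_def)
    moreover have "(\<lambda>N. 2 * c f / Suc N) \<longlonglongrightarrow> 0"
      by (rule lim_const_over_n[THEN LIMSEQ_Suc])
    ultimately have "\<bar>M f - M (f \<circ> t)\<bar> \<le> 0"
      by (intro LIMSEQ_le_const) auto
    then show ?thesis by simp
  qed
  then have "invariant_under V (S \<union> T) M"
    using M(2) by (auto simp: invariant_under_def)
  with M(1) show ?thesis by blast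
qed

end


section \<open>The group and its normal series\<close>

lemma GN_simps [simp]:
  "carrier GN = {x. upper_triangular_pos (fst x)}"
  "x \<otimes>\<^bsub>GN\<^esub> y = (fst x ** fst y, fst x *v snd y + snd x)"
  "\<one>\<^bsub>GN\<^esub> = (mat 1, 0)"
  by (auto simp: GN_def split: prod.splits)

lemma decreasing_induct:
  fixes i :: "'n::{finite,linorder}"
  assumes "\<And>i. (\<And>k. i < k \<Longrightarrow> P k) \<Longrightarrow> P i"
  shows "P i"
proof (induction "card {i<..}" arbitrary: i rule: less_induct)
  case less
  show ?case
  proof (rule assms)
    fix k assume "i < k"
    then have "{k<..} \<subset> {i<..}" by auto
    then show "P k" by (intro less psubset_card_mono) auto
  qed
qed

lemma matrix_mult_entry: "(A ** B) $ i $ j = (\<Sum>k\<in>UNIV. A $ i $ k * B $ k $ j)"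
  by (simp add: matrix_matrix_mult_def)

lemma matrix_vector_entry: "(A *v x) $ i = (\<Sum>k\<in>UNIV. A $ i $ k * x $ k)"
  by (simp add: matrix_vector_mult_def)

lemma upper_triangular_pos_mat_1: "upper_triangular_pos (mat 1)"
  by (auto simp: upper_triangular_pos_def mat_def)

lemma upper_triangular_pos_entry_mult_eq_0:
  assumes "upper_triangular_pos A" "upper_triangular_pos B" "\<not> (i \<le> k \<and> k \<le> j)"
  shows "A $ i $ k * B $ k $ j = 0"
  using assms by (auto simp: upper_triangular_pos_def not_le)

lemma upper_triangular_pos_mult_diagonal:
  assumes "upper_triangular_pos A" "upper_triangular_pos B"
  shows "(A ** B) $ i $ i = A $ i $ i * B $ i $ i"
proof -
  have "(A ** B) $ i $ i = (\<Sum>k\<in>{i}. A $ i $ k * B $ k $ i)"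
    unfolding matrix_mult_entry
    by (rule sum.mono_neutral_right) (use upper_triangular_pos_entry_mult_eq_0[OF assms] in force)+
  then show ?thesis by simp
qed

lemma upper_triangular_pos_mult:
  assumes "upper_triangular_pos A" "upper_triangular_pos B"
  shows "upper_triangular_pos (A ** B)"
  unfolding upper_triangular_pos_def
proof (intro conjI allI impI)
  fix i j :: 'a assume "j < i"
  then show "(A ** B) $ i $ j = 0"
    unfolding matrix_mult_entry
    by (intro sum.neutral ballI upper_triangular_pos_entry_mult_eq_0[OF assms]) auto
next
  fix i show "0 < (A ** B) $ i $ i"
    using assms by (simp add: upper_triangular_pos_mult_diagonal) (simp add: upper_triangular_pos_def)
qed

lemma upper_triangular_pos_sum_split:
  fixes f :: "'n::{finite,linorder} \<Rightarrow> real"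
  assumes "upper_triangular_pos A"
  shows "(\<Sum>k\<in>UNIV. A $ i $ k * f k) = A $ i $ i * f i + (\<Sum>k\<in>{i<..}. A $ i $ k * f k)"
proof -
  have "(\<Sum>k\<in>UNIV. A $ i $ k * f k) = (\<Sum>k\<in>insert i {i<..}. A $ i $ k * f k)"
    by (rule sum.mono_neutral_right) (use assms in \<open>auto simp: upper_triangular_pos_def\<close>)
  then show ?thesis by simp
qed

text \<open>
  With \<open>J\<close> the set of all indices this says that the matrix is injective. With \<open>J = {j<..}\<close>, applied to
  the \<open>j\<close>-th column of the inverse, it says that the inverse is upper triangular.
\<close>

lemma upper_triangular_pos_back_substitution:
  assumes A: "upper_triangular_pos A" and J: "\<And>i k. i \<in> J \<Longrightarrow> i < k \<Longrightarrow> k \<in> J"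
    and 0: "\<And>i. i \<in> J \<Longrightarrow> (A *v x) $ i = 0"
  shows "i \<in> J \<Longrightarrow> x $ i = 0"
proof (induction i rule: decreasing_induct)
  case (1 i)
  then have "(\<Sum>k\<in>{i<..}. A $ i $ k * x $ k) = 0"
    using J by (intro sum.neutral) auto
  then have "A $ i $ i * x $ i = 0"
    using 0[OF 1(2)] upper_triangular_pos_sum_split[OF A, of i "($) x"]
    by (simp add: matrix_vector_entry)
  then show ?case using A by (auto simp: upper_triangular_pos_def less_le)
qed

lemma upper_triangular_pos_invertible:
  assumes "upper_triangular_pos A"
  shows "invertible A"
proof -
  have "x = 0" if "A *v x = 0" for x
    using upper_triangular_pos_back_substitution[OF assms, of UNIV x] that by (auto simp: vec_eq_iff)
  then show ?thesis
    by (simp add: invertible_left_inverse matrix_left_invertible_ker)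
qed

lemma
  assumes "upper_triangular_pos A"
  shows matrix_inv_mult_right: "A ** matrix_inv A = mat 1"
    and matrix_inv_mult_left: "matrix_inv A ** A = mat 1"
  using someI_ex[OF upper_triangular_pos_invertible[OF assms, unfolded invertible_def]]
  by (simp_all add: matrix_inv_def)

lemma upper_triangular_pos_matrix_inv:
  assumes A: "upper_triangular_pos A"
  shows "upper_triangular_pos (matrix_inv A)"
proof -
  let ?B = "matrix_inv A"
  have col: "(A *v column j ?B) $ i = (if i = j then 1 else 0)" for i j
    using arg_cong[OF matrix_inv_mult_right[OF A], of "\<lambda>C. C $ i $ j"]
    by (simp add: matrix_mult_entry matrix_vector_entry column_def mat_def)
  have 0: "?B $ i $ j = 0" if "j < i" for i j
    using upper_triangular_pos_back_substitution[OF A, of "{j<..}" "column j ?B" i] that col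
    by (auto simp: column_def)
  have "A $ i $ i * ?B $ i $ i = 1" for i
    using col[of i i] upper_triangular_pos_sum_split[OF A, of i "\<lambda>k. ?B $ k $ i"] 0
    by (simp add: matrix_vector_entry column_def)
  then have "0 < ?B $ i $ i" for i
    using A unfolding upper_triangular_pos_def by (metis zero_less_mult_pos zero_less_one)
  with 0 show ?thesis by (simp add: upper_triangular_pos_def)
qed

text \<open>
  Associativity on the whole type lets compositions of left translations be computed as equalities of
  functions, without restriction to the carrier.
\<close>

lemma GN_assoc:
  fixes x y z :: "'n::{finite,linorder} mat_vec"
  shows "(x \<otimes>\<^bsub>GN\<^esub> y) \<otimes>\<^bsub>GN\<^esub> z = x \<otimes>\<^bsub>GN\<^esub> (y \<otimes>\<^bsub>GN\<^esub> z)"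
  by (simp add: matrix_mul_assoc matrix_vector_mul_assoc matrix_vector_right_distrib)

lemma group_GN: "group (GN :: 'n::{finite,linorder} mat_vec monoid)"
proof (rule groupI)
  fix x :: "'n mat_vec" assume x: "x \<in> carrier GN"
  show "\<exists>y\<in>carrier GN. y \<otimes>\<^bsub>GN\<^esub> x = \<one>\<^bsub>GN\<^esub>"
    using x by (intro bexI[of _ "(matrix_inv (fst x), - (matrix_inv (fst x) *v snd x))"])
      (simp_all add: matrix_inv_mult_left upper_triangular_pos_matrix_inv)
next
  fix x y z :: "'n mat_vec"
  show "(x \<otimes>\<^bsub>GN\<^esub> y) \<otimes>\<^bsub>GN\<^esub> z = x \<otimes>\<^bsub>GN\<^esub> (y \<otimes>\<^bsub>GN\<^esub> z)" by (rule GN_assoc)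
qed (simp_all add: upper_triangular_pos_mult upper_triangular_pos_mat_1)

lemma inv_GN:
  assumes "x \<in> carrier GN"
  shows "inv\<^bsub>GN\<^esub> x = (matrix_inv (fst x), - (matrix_inv (fst x) *v snd x))"
  using assms
  by (intro group.inv_equality[OF group_GN])
    (simp_all add: matrix_inv_mult_left upper_triangular_pos_matrix_inv)

text \<open>
  Numbers the rows and columns from \<open>0\<close>, so that distances from the diagonal can be measured.
\<close>

definition position :: "'n::{finite,linorder} \<Rightarrow> nat" where
  "position i = card {..<i}"

lemma position_less: "position (i::'n::{finite,linorder}) < CARD('n)"
  unfolding position_def by (intro psubset_card_mono) auto

lemma position_mono: "i \<le> j \<Longrightarrow> position i \<le> position j"
  unfolding position_def by (intro card_mono) auto

lemma position_strict_mono: "i < j \<Longrightarrow> position i < position j"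
  unfolding position_def by (intro psubset_card_mono) auto

lemma position_eq_iff: "position i = position j \<longleftrightarrow> i = j"
  by (metis less_irrefl linorder_cases position_strict_mono)

text \<open>
  The vector counts as a further column at position \<open>n\<close>, as in the embedding of affine maps into matrices of
  size \<open>n + 1\<close>. On the group, \<open>agree k\<close> compares the entries at distance less than \<open>k\<close> from the diagonal.
  It is a congruence, and the class of the identity is a term of the descending normal series.
\<close>

definition agree :: "nat \<Rightarrow> 'n::{finite,linorder} mat_vec \<Rightarrow> 'n mat_vec \<Rightarrow> bool" where
  "agree k x y \<longleftrightarrow>
     (\<forall>i j. position j < position i + k \<longrightarrow> fst x $ i $ j = fst y $ i $ j) \<and>
     (\<forall>i. CARD('n) < position i + k \<longrightarrow> snd x $ i = snd y $ i)"

text \<open>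
  An entry \<open>(i, j)\<close> of a product of upper triangular matrices only involves entries \<open>(i, l)\<close> and \<open>(l, j)\<close> with
  \<open>i \<le> l \<le> j\<close>, and these are not further away from the diagonal.
\<close>

lemma agree_mult:
  fixes x x' y y' :: "'n::{finite,linorder} mat_vec"
  assumes G: "x \<in> carrier GN" "x' \<in> carrier GN" "y \<in> carrier GN" "y' \<in> carrier GN"
    and agr: "agree k x x'" "agree k y y'"
  shows "agree k (x \<otimes>\<^bsub>GN\<^esub> y) (x' \<otimes>\<^bsub>GN\<^esub> y')"
  unfolding agree_def
proof (intro conjI allI impI)
  fix i j :: 'n assume less: "position j < position i + k"
  have "fst x $ i $ l * fst y $ l $ j = fst x' $ i $ l * fst y' $ l $ j" for l
  proof (cases "i \<le> l \<and> l \<le> j")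
    case True
    then have "position i \<le> position l" "position l \<le> position j"
      by (simp_all add: position_mono)
    with less agr show ?thesis by (simp add: agree_def)
  next
    case False
    then show ?thesis using G by (simp add: upper_triangular_pos_entry_mult_eq_0)
  qed
  then show "fst (x \<otimes>\<^bsub>GN\<^esub> y) $ i $ j = fst (x' \<otimes>\<^bsub>GN\<^esub> y') $ i $ j"
    by (simp add: matrix_mult_entry)
next
  fix i :: 'n assume less: "CARD('n) < position i + k"
  have "fst x $ i $ l * snd y $ l = fst x' $ i $ l * snd y' $ l" for l
  proof (cases "i \<le> l")
    case True
    then have "position i \<le> position l" "position l < CARD('n)"
      by (simp_all add: position_mono position_less)
    with less agr show ?thesis by (simp add: agree_def)
  next
    case False
    then show ?thesis using G by (auto simp: upper_triangular_pos_def)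
  qed
  then show "snd (x \<otimes>\<^bsub>GN\<^esub> y) $ i = snd (x' \<otimes>\<^bsub>GN\<^esub> y') $ i"
    using agr less by (simp add: matrix_vector_entry agree_def)
qed

lemma agree_sym: "agree k x y \<Longrightarrow> agree k y x"
  by (simp add: agree_def)

lemma agree_trans: "agree k x y \<Longrightarrow> agree k y z \<Longrightarrow> agree k x z"
  by (simp add: agree_def)

text \<open>
  The summands strictly between \<open>i\<close> and \<open>j\<close> contain an entry of \<open>x\<close> at a positive distance less than \<open>k\<close> from
  the diagonal, which vanishes.
\<close>

lemma superdiagonal_entry_mult:
  fixes x y :: "'n::{finite,linorder} mat_vec"
  assumes G: "x \<in> carrier GN" "y \<in> carrier GN"
    and agr: "agree k x \<one>\<^bsub>GN\<^esub>" "agree k y \<one>\<^bsub>GN\<^esub>"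
    and k: "0 < k" "position j = position i + k"
  shows "fst (x \<otimes>\<^bsub>GN\<^esub> y) $ i $ j = fst x $ i $ j + fst y $ i $ j"
proof -
  have ij: "i < j"
    using k by (metis add.commute le_add1 less_add_same_cancel2 not_less position_mono leD)
  have one: "fst z $ l $ l = 1" if "agree k z \<one>\<^bsub>GN\<^esub>" for l and z :: "'n mat_vec"
    using that k by (simp add: agree_def mat_def)
  have "fst (x \<otimes>\<^bsub>GN\<^esub> y) $ i $ j = (\<Sum>l\<in>{i, j}. fst x $ i $ l * fst y $ l $ j)"
    unfolding GN_simps fst_conv matrix_mult_entry
  proof (rule sum.mono_neutral_right)
    show "\<forall>l\<in>UNIV - {i, j}. fst x $ i $ l * fst y $ l $ j = 0"
    proof
      fix l assume l: "l \<in> UNIV - {i, j}"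
      show "fst x $ i $ l * fst y $ l $ j = 0"
      proof (cases "i \<le> l \<and> l \<le> j")
        case True
        with l have "i < l" "l < j" by auto
        then have "position l < position i + k" using k position_strict_mono by metis
        with agr(1) \<open>i < l\<close> show ?thesis by (simp add: agree_def mat_def)
      next
        case False
        then show ?thesis using G by (simp add: upper_triangular_pos_entry_mult_eq_0)
      qed
    qed
  qed auto
  then show ?thesis using ij one[OF agr(1), of i] one[OF agr(2), of j] by simp
qed

text \<open>
  The first new diagonal is multiplied entrywise if \<open>k = 0\<close> and added otherwise; both operations are
  commutative.
\<close>

lemma agree_commute:
  fixes x y :: "'n::{finite,linorder} mat_vec"
  assumes G: "x \<in> carrier GN" "y \<in> carrier GN"
    and agr: "agree k x \<one>\<^bsub>GN\<^esub>" "agree k y \<one>\<^bsub>GN\<^esub>"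
  shows "agree (Suc k) (x \<otimes>\<^bsub>GN\<^esub> y) (y \<otimes>\<^bsub>GN\<^esub> x)"
proof -
  have one: "\<one>\<^bsub>GN\<^esub> \<in> carrier (GN :: 'n mat_vec monoid)"
    by (simp add: upper_triangular_pos_mat_1)
  have "agree k (x \<otimes>\<^bsub>GN\<^esub> y) (\<one>\<^bsub>GN\<^esub> \<otimes>\<^bsub>GN\<^esub> \<one>\<^bsub>GN\<^esub>)" "agree k (y \<otimes>\<^bsub>GN\<^esub> x) (\<one>\<^bsub>GN\<^esub> \<otimes>\<^bsub>GN\<^esub> \<one>\<^bsub>GN\<^esub>)"
    using G agr one by (blast intro: agree_mult)+
  then have le: "agree k (x \<otimes>\<^bsub>GN\<^esub> y) (y \<otimes>\<^bsub>GN\<^esub> x)"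
    by (blast intro: agree_trans agree_sym)
  show ?thesis
    unfolding agree_def
  proof (intro conjI allI impI)
    fix i j :: 'n assume "position j < position i + Suc k"
    then consider "position j < position i + k" | "0 < k" "position j = position i + k"
      | "k = 0" "position j = position i"
      by linarith
    then show "fst (x \<otimes>\<^bsub>GN\<^esub> y) $ i $ j = fst (y \<otimes>\<^bsub>GN\<^esub> x) $ i $ j"
    proof cases
      case 1
      then show ?thesis using le unfolding agree_def by blast
    next
      case 2
      then show ?thesis
        using superdiagonal_entry_mult[OF G agr] superdiagonal_entry_mult[OF G(2,1) agr(2,1)] by simp
    next
      case 3
      then show ?thesis
        using G by (simp add: position_eq_iff upper_triangular_pos_mult_diagonal)
    qed
  next
    fix i :: 'n assume "CARD('n) < position i + Suc k"
    then consider "CARD('n) < position i + k" | "CARD('n) = position i + k"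
      by linarith
    then show "snd (x \<otimes>\<^bsub>GN\<^esub> y) $ i = snd (y \<otimes>\<^bsub>GN\<^esub> x) $ i"
    proof cases
      case 1
      then show ?thesis using le unfolding agree_def by blast
    next
      case 2
      have "fst z $ i $ l = (if l = i then 1 else 0)" if "agree k z \<one>\<^bsub>GN\<^esub>" for l and z :: "'n mat_vec"
        using that position_less[of l] 2 by (auto simp: agree_def mat_def)
      then have row: "(fst z *v v) $ i = v $ i" if "agree k z \<one>\<^bsub>GN\<^esub>" for v and z :: "'n mat_vec"
        using that by (simp add: matrix_vector_entry if_distrib[of "\<lambda>t. t * _"] cong: if_cong)
      show ?thesis using row[OF agr(1)] row[OF agr(2)] by simp
    qed
  qed
qed

text \<open>
  The normal series that exhibits the group as solvable.
\<close>

definition GN_level :: "nat \<Rightarrow> 'n::{finite,linorder} mat_vec set" where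
  "GN_level k = {x \<in> carrier GN. agree k x \<one>\<^bsub>GN\<^esub>}"

lemma GN_level_0: "GN_level 0 = carrier GN"
proof -
  have "agree 0 x \<one>\<^bsub>GN\<^esub>" if "x \<in> carrier GN" for x :: "'a mat_vec"
    unfolding agree_def
  proof (intro conjI allI impI)
    fix i j :: 'a assume "position j < position i + 0"
    then have "j < i" using position_mono[of i j] by (cases "i \<le> j") auto
    then show "fst x $ i $ j = fst \<one>\<^bsub>GN\<^esub> $ i $ j"
      using that by (simp add: upper_triangular_pos_def mat_def)
  next
    fix i :: 'a assume "CARD('a) < position i + 0"
    then show "snd x $ i = snd \<one>\<^bsub>GN\<^esub> $ i" using position_less[of i] by simp
  qed
  then show ?thesis unfolding GN_level_def by blast
qed

lemma GN_level_top: "GN_level (Suc CARD('n)) = {\<one>\<^bsub>GN\<^esub> :: 'n::{finite,linorder} mat_vec}"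
proof -
  have "position j < position i + Suc CARD('n)" for i j :: 'n
    using position_less[of j] by linarith
  then show ?thesis
    by (auto simp: GN_level_def agree_def vec_eq_iff prod_eq_iff upper_triangular_pos_mat_1)
qed

lemma GN_level_memI:
  fixes x y :: "'n::{finite,linorder} mat_vec"
  assumes "x \<in> carrier GN" "y \<in> carrier GN" "agree k x y"
  shows "\<exists>s\<in>GN_level k. x = y \<otimes>\<^bsub>GN\<^esub> s"
proof -
  interpret group "GN :: 'n mat_vec monoid" by (rule group_GN)
  let ?s = "inv\<^bsub>GN\<^esub> y \<otimes>\<^bsub>GN\<^esub> x"
  have "agree k (inv\<^bsub>GN\<^esub> y) (inv\<^bsub>GN\<^esub> y)" by (simp add: agree_def)
  then have "agree k ?s (inv\<^bsub>GN\<^esub> y \<otimes>\<^bsub>GN\<^esub> y)"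
    using assms by (intro agree_mult inv_closed)
  then have "?s \<in> GN_level k"
    using assms by (simp only: GN_level_def l_inv inv_closed m_closed mem_Collect_eq)
  moreover have "x = y \<otimes>\<^bsub>GN\<^esub> ?s"
    using assms by (simp only: inv_solve_left' m_assoc[symmetric] r_inv l_one inv_closed m_closed)
  ultimately show ?thesis by blast
qed

abbreviation left_mult :: "'n::{finite,linorder} mat_vec \<Rightarrow> 'n mat_vec \<Rightarrow> 'n mat_vec" where
  "left_mult g \<equiv> (\<lambda>x. g \<otimes>\<^bsub>GN\<^esub> x)"

lemma left_mult_comp: "left_mult g \<circ> left_mult h = left_mult (g \<otimes>\<^bsub>GN\<^esub> h)"
  by (simp only: fun_eq_iff comp_def GN_assoc) simp

text \<open>
  Every mean is invariant under the last, trivial term of the normal series. Going up the series, each term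
  normalises the next smaller one and is commutative modulo it.
\<close>

theorem GN_invariant_mean_exists:
  fixes V :: "('n::{finite,linorder} mat_vec \<Rightarrow> real) set"
  assumes "order_unit_function_space V P"
    and V: "\<And>g f. g \<in> carrier GN \<Longrightarrow> f \<in> V \<Longrightarrow> f \<circ> left_mult g \<in> V"
    and P: "\<And>g f. g \<in> carrier GN \<Longrightarrow> P f \<Longrightarrow> P (f \<circ> left_mult g)"
    and M0: "mean_on V P M0"
  shows "\<exists>M. mean_on V P M \<and> invariant_under V (left_mult ` carrier GN) M"
proof -
  interpret order_unit_function_space V P by fact
  interpret group "GN :: 'n mat_vec monoid" by (rule group_GN)
  have sub: "GN_level k \<subseteq> carrier GN" for k
    unfolding GN_level_def by blast
  have "\<exists>M. mean_on V P M \<and> invariant_under V (left_mult ` GN_level k) M" if "k \<le> Suc CARD('n)" for k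
    using that
  proof (induction k rule: inc_induct)
    case base
    have "left_mult \<one>\<^bsub>GN\<^esub> = (id :: 'n mat_vec \<Rightarrow> _)"
      by (simp add: fun_eq_iff)
    then have "invariant_under V (left_mult ` GN_level (Suc CARD('n))) M0"
      unfolding GN_level_top by (simp add: invariant_under_def comp_def del: GN_simps)
    with M0 show ?case by blast
  next
    case (step k)
    then obtain M where M: "mean_on V P M" "invariant_under V (left_mult ` GN_level (Suc k)) M"
      by blast
    have "\<exists>M. mean_on V P M \<and>
        invariant_under V (left_mult ` GN_level (Suc k) \<union> left_mult ` GN_level k) M"
    proof (rule invariant_mean_extension[OF _ _ _ _ M])
      show "f \<circ> s \<in> V" if "s \<in> left_mult ` GN_level (Suc k) \<union> left_mult ` GN_level k" "f \<in> V" for s f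
        using that V sub by blast
      show "P (f \<circ> s)" if "s \<in> left_mult ` GN_level (Suc k) \<union> left_mult ` GN_level k" "P f" for s f
        using that P sub by blast
    next
      fix s' t' :: "'n mat_vec \<Rightarrow> 'n mat_vec"
      assume "s' \<in> left_mult ` GN_level (Suc k)" "t' \<in> left_mult ` GN_level k"
      then obtain s t where st: "s' = left_mult s" "s \<in> GN_level (Suc k)" "t' = left_mult t" "t \<in> GN_level k"
        by blast
      then have G: "s \<in> carrier GN" "t \<in> carrier GN" using sub by blast+
      have "agree (Suc k) t t" by (simp add: agree_def)
      then have "agree (Suc k) (s \<otimes>\<^bsub>GN\<^esub> t) (\<one>\<^bsub>GN\<^esub> \<otimes>\<^bsub>GN\<^esub> t)"
        using G st(2) by (intro agree_mult one_closed) (simp_all only: GN_level_def mem_Collect_eq)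
      then obtain r where r: "r \<in> GN_level (Suc k)" "s \<otimes>\<^bsub>GN\<^esub> t = t \<otimes>\<^bsub>GN\<^esub> r"
        using G GN_level_memI[of "s \<otimes>\<^bsub>GN\<^esub> t" t "Suc k"] m_closed l_one by metis
      then have "s' \<circ> t' = t' \<circ> left_mult r"
        by (simp only: st left_mult_comp)
      then show "\<exists>r'\<in>left_mult ` GN_level (Suc k). s' \<circ> t' = t' \<circ> r'"
        using r(1) by blast
    next
      fix s' t' :: "'n mat_vec \<Rightarrow> 'n mat_vec"
      assume "s' \<in> left_mult ` GN_level k" "t' \<in> left_mult ` GN_level k"
      then obtain s t where st: "s' = left_mult s" "s \<in> GN_level k" "t' = left_mult t" "t \<in> GN_level k"
        by blast
      then have G: "s \<in> carrier GN" "t \<in> carrier GN" using sub by blast+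
      have "agree (Suc k) (s \<otimes>\<^bsub>GN\<^esub> t) (t \<otimes>\<^bsub>GN\<^esub> s)"
        using st G unfolding GN_level_def by (intro agree_commute) blast+
      then obtain r where r: "r \<in> GN_level (Suc k)" "s \<otimes>\<^bsub>GN\<^esub> t = (t \<otimes>\<^bsub>GN\<^esub> s) \<otimes>\<^bsub>GN\<^esub> r"
        using G GN_level_memI[of "s \<otimes>\<^bsub>GN\<^esub> t" "t \<otimes>\<^bsub>GN\<^esub> s" "Suc k"] m_closed by metis
      then have "s' \<circ> t' = t' \<circ> s' \<circ> left_mult r"
        by (simp only: st left_mult_comp)
      then show "\<exists>r'\<in>left_mult ` GN_level (Suc k). s' \<circ> t' = t' \<circ> s' \<circ> r'"
        using r(1) by blast
    qed
    then show ?case by (auto simp: invariant_under_def)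
  qed
  from this[of 0] show ?thesis unfolding GN_level_0 by blast
qed


section \<open>Smoothness of rational functions\<close>

text \<open>
  A class of functions that is closed under directional derivatives, so that smoothness needs no formulas for
  higher derivatives. Closure under agreement on \<open>S\<close> belongs to the definition because derivatives are only
  controlled at points of \<open>S\<close>.
\<close>

inductive rational_on :: "'a::euclidean_space set \<Rightarrow> ('a \<Rightarrow> real) \<Rightarrow> bool" for S where
  linear: "bounded_linear f \<Longrightarrow> rational_on S f"
| const: "rational_on S (\<lambda>x. c)"
| add: "rational_on S f \<Longrightarrow> rational_on S g \<Longrightarrow> rational_on S (\<lambda>x. f x + g x)"
| mult: "rational_on S f \<Longrightarrow> rational_on S g \<Longrightarrow> rational_on S (\<lambda>x. f x * g x)"
| inverse: "rational_on S f \<Longrightarrow> (\<And>x. x \<in> S \<Longrightarrow> f x \<noteq> 0) \<Longrightarrow> rational_on S (\<lambda>x. inverse (f x))"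
| cong: "rational_on S f \<Longrightarrow> (\<And>x. x \<in> S \<Longrightarrow> f x = g x) \<Longrightarrow> rational_on S g"

lemma rational_on_minus: "rational_on S f \<Longrightarrow> rational_on S (\<lambda>x. - f x)"
  using rational_on.mult[OF rational_on.const[of S "-1"], of f] by simp

lemma rational_on_diff:
  "rational_on S f \<Longrightarrow> rational_on S g \<Longrightarrow> rational_on S (\<lambda>x. f x - g x)"
  using rational_on.add[OF _ rational_on_minus, of S f g] by simp

lemma rational_on_divide:
  "rational_on S f \<Longrightarrow> rational_on S g \<Longrightarrow> (\<And>x. x \<in> S \<Longrightarrow> g x \<noteq> 0) \<Longrightarrow> rational_on S (\<lambda>x. f x / g x)"
  unfolding divide_inverse by (intro rational_on.mult rational_on.inverse)

lemma rational_on_sum: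
  assumes "\<And>i. i \<in> I \<Longrightarrow> rational_on S (f i)"
  shows "rational_on S (\<lambda>x. \<Sum>i\<in>I. f i x)"
  using assms
  by (induction I rule: infinite_finite_induct) (auto intro: rational_on.const rational_on.add)

lemma rational_on_derivative:
  assumes "rational_on S f" and S: "open S"
  shows "\<exists>f'. (\<forall>x\<in>S. (f has_derivative f' x) (at x)) \<and> (\<forall>v. rational_on S (\<lambda>x. f' x v))"
  using assms(1)
proof induction
  case (linear f)
  then show ?case
    by (intro exI[of _ "\<lambda>_. f"]) (auto intro: bounded_linear_imp_has_derivative rational_on.const)
next
  case (const c)
  show ?case
    by (intro exI[of _ "\<lambda>_ _. 0"]) (auto intro: rational_on.const)
next
  case (add f g)
  then obtain f' g' where
    "\<forall>x\<in>S. (f has_derivative f' x) (at x)" "\<forall>v. rational_on S (\<lambda>x. f' x v)"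
    "\<forall>x\<in>S. (g has_derivative g' x) (at x)" "\<forall>v. rational_on S (\<lambda>x. g' x v)"
    by blast
  then show ?case
    by (intro exI[of _ "\<lambda>x v. f' x v + g' x v"]) (auto intro: rational_on.add has_derivative_add)
next
  case (mult f g)
  then obtain f' g' where
    "\<forall>x\<in>S. (f has_derivative f' x) (at x)" "\<forall>v. rational_on S (\<lambda>x. f' x v)"
    "\<forall>x\<in>S. (g has_derivative g' x) (at x)" "\<forall>v. rational_on S (\<lambda>x. g' x v)"
    by blast
  with mult.hyps show ?case
    by (intro exI[of _ "\<lambda>x v. f x * g' x v + f' x v * g x"] conjI ballI allI has_derivative_mult
        rational_on.add[OF rational_on.mult rational_on.mult]) auto
next
  case (inverse f)
  then obtain f' where
    "\<forall>x\<in>S. (f has_derivative f' x) (at x)" "\<forall>v. rational_on S (\<lambda>x. f' x v)"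
    by blast
  with inverse.hyps show ?case
    by (intro exI[of _ "\<lambda>x v. - (inverse (f x) * f' x v * inverse (f x))"])
      (auto intro!: rational_on_minus rational_on.mult rational_on.inverse has_derivative_inverse)
next
  case (cong f g)
  then obtain f' where
    "\<forall>x\<in>S. (f has_derivative f' x) (at x)" "\<forall>v. rational_on S (\<lambda>x. f' x v)"
    by blast
  with cong.hyps show ?case
    by (intro exI[of _ f']) (use S in \<open>auto intro: has_derivative_transform_within_open\<close>)
qed

text \<open>
  Induction on \<open>k\<close> with \<open>f\<close> arbitrary: the components of a directional derivative are again of the same
  class.
\<close>

lemma rational_imp_Ck_on:
  fixes f :: "'a::euclidean_space \<Rightarrow> 'b::euclidean_space"
  assumes "open S" "\<And>b. b \<in> Basis \<Longrightarrow> rational_on S (\<lambda>x. f x \<bullet> b)"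
  shows "Ck_on k S f"
  using assms(2)
proof (induction k arbitrary: f)
  case 0
  have "continuous_on S (\<lambda>x. f x \<bullet> b)" if "b \<in> Basis" for b
    using rational_on_derivative[OF 0[OF that] assms(1)]
    by (meson continuous_at_imp_continuous_on has_derivative_continuous)
  then show ?case
    by (simp add: continuous_on_componentwise[of S f])
next
  case (Suc k)
  obtain f' where f': "\<And>b x. b \<in> Basis \<Longrightarrow> x \<in> S \<Longrightarrow> ((\<lambda>x. f x \<bullet> b) has_derivative f' b x) (at x)"
      and rat: "\<And>b v. b \<in> Basis \<Longrightarrow> rational_on S (\<lambda>x. f' b x v)"
    using rational_on_derivative[OF Suc.prems assms(1)] by metis
  have der: "(f has_derivative (\<lambda>v. \<Sum>b\<in>Basis. f' b x v *\<^sub>R b)) (at x)" if "x \<in> S" for x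
    by (subst has_derivative_componentwise_within) (use f' that in simp)
  have fd: "frechet_derivative f (at x) v \<bullet> b = f' b x v" if "x \<in> S" "b \<in> Basis" for x v b
    using that(2) by (simp flip: frechet_derivative_at[OF der[OF that(1)]] add: inner_sum_left_Basis)
  have "Ck_on k S (\<lambda>x. frechet_derivative f (at x) v)" for v
    by (rule Suc.IH) (rule rational_on.cong[OF rat], auto simp: fd)
  moreover have "\<forall>x\<in>S. f differentiable at x"
    using der differentiable_def by blast
  ultimately show ?case by simp
qed

lemma rational_imp_smooth_on:
  fixes f :: "'a::euclidean_space \<Rightarrow> (real ^ 'k) \<times> (real ^ 'l)"
  assumes "open S" "\<And>i. rational_on S (\<lambda>x. fst (f x) $ i)" "\<And>i. rational_on S (\<lambda>x. snd (f x) $ i)"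
  shows "smooth_on S f"
proof -
  have "rational_on S (\<lambda>x. f x \<bullet> b)" if b: "b \<in> Basis" for b
  proof -
    from b consider i where "b = (axis i 1, 0)" | i where "b = (0, axis i 1)"
      by (auto simp: Basis_prod_def Basis_vec_def)
    then show ?thesis
      using assms(2,3) by cases (simp_all add: inner_prod_def inner_axis)
  qed
  then show ?thesis
    using rational_imp_Ck_on[of S f] assms(1) by (auto simp: smooth_on_def)
qed


section \<open>The Lie group structure\<close>

type_synonym 'n chart_space = "(real, 'n upper_index) vec \<times> (real, 'n) vec"

definition upper :: "'n::linorder \<Rightarrow> 'n \<Rightarrow> 'n upper_index" where
  "upper i j = Abs_upper_index (i, j)"

lemma Rep_upper [simp]: "i \<le> j \<Longrightarrow> Rep_upper_index (upper i j) = (i, j)"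
  by (simp add: upper_def Abs_upper_index_inverse)

lemma upper_index_cases:
  obtains i j where "i \<le> j" "p = upper i j"
  by (cases p rule: Abs_upper_index_cases) (auto simp: upper_def)

text \<open>
  A linear right inverse of the chart on the whole coordinate space; it takes values in the group exactly on
  the image of the chart.
\<close>

definition unchart :: "'n::{finite,linorder} chart_space \<Rightarrow> 'n mat_vec" where
  "unchart e = (\<chi> i j. if i \<le> j then fst e $ upper i j else 0, snd e)"

definition chart_domain :: "'n::{finite,linorder} chart_space set" where
  "chart_domain = {e. \<forall>i. 0 < fst e $ upper i i}"

lemma GN_chart_eq: "GN_chart x = (\<chi> p. fst x $ fst (Rep_upper_index p) $ snd (Rep_upper_index p), snd x)"
  by (cases x) (simp add: GN_chart_def case_prod_unfold)

lemma GN_chart_upper [simp]: "i \<le> j \<Longrightarrow> fst (GN_chart x) $ upper i j = fst x $ i $ j"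
  by (simp add: GN_chart_eq)

lemma snd_GN_chart [simp]: "snd (GN_chart x) = snd x"
  by (simp add: GN_chart_eq)

lemma chart_space_eqI:
  assumes "\<And>i j. i \<le> j \<Longrightarrow> fst e $ upper i j = fst e' $ upper i j" "snd e = snd e'"
  shows "e = e'"
  using assms by (metis prod_eqI upper_index_cases vec_eq_iff)

lemma GN_chart_unchart [simp]: "GN_chart (unchart e) = e"
  by (rule chart_space_eqI) (simp_all add: unchart_def)

lemma unchart_GN_chart: "x \<in> carrier GN \<Longrightarrow> unchart (GN_chart x) = x"
  by (auto simp: prod_eq_iff vec_eq_iff unchart_def upper_triangular_pos_def)

lemma unchart_in_GN_iff: "unchart e \<in> carrier GN \<longleftrightarrow> e \<in> chart_domain"
  by (auto simp: unchart_def upper_triangular_pos_def chart_domain_def)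

lemma GN_chart_image: "GN_chart ` carrier GN = (chart_domain :: 'n::{finite,linorder} chart_space set)"
proof
  show "GN_chart ` carrier GN \<subseteq> (chart_domain :: 'n chart_space set)"
    by (auto simp: chart_domain_def upper_triangular_pos_def)
  show "(chart_domain :: 'n chart_space set) \<subseteq> GN_chart ` carrier GN"
    by (metis GN_chart_unchart image_eqI subsetI unchart_in_GN_iff)
qed

lemma inj_on_GN_chart: "inj_on GN_chart (carrier GN)"
  by (rule inj_on_inverseI[of _ unchart]) (rule unchart_GN_chart)

lemma inv_into_GN_chart: "e \<in> chart_domain \<Longrightarrow> inv_into (carrier GN) GN_chart e = unchart e"
  by (rule inv_into_f_eq) (simp_all only: inj_on_GN_chart unchart_in_GN_iff GN_chart_unchart)

lemma open_chart_domain: "open chart_domain"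
proof -
  have "chart_domain = (\<Inter>i. {e::'a chart_space. 0 < fst e $ upper i i})"
    by (auto simp: chart_domain_def)
  also have "open \<dots>"
    by (intro open_INT[OF finite] ballI open_Collect_less continuous_intros)
  finally show ?thesis .
qed

lemma continuous_on_GN_chart: "continuous_on A GN_chart"
  unfolding GN_chart_eq by (intro continuous_intros)

lemma continuous_on_unchart: "continuous_on A unchart"
proof -
  have "continuous_on A (\<lambda>e. if i \<le> j then fst e $ upper i j else 0)" for i j :: 'a
    by (cases "i \<le> j") (auto intro!: continuous_intros)
  then show ?thesis
    unfolding unchart_def by (intro continuous_intros)
qed

lemma homeomorphic_maps_GN_chart:
  "homeomorphic_maps GN_topology (top_of_set chart_domain) GN_chart unchart"
proof -
  have "unchart ` chart_domain \<subseteq> (carrier GN :: 'a mat_vec set)"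
    using unchart_in_GN_iff by blast
  then show ?thesis
    using GN_chart_image[where ?'n = 'a] unchart_GN_chart
    by (auto simp: homeomorphic_maps_def GN_topology_def continuous_map_in_subtopology
        continuous_on_GN_chart continuous_on_unchart image_subset_iff_funcset simp del: GN_simps)
qed

lemma rational_on_component:
  fixes S :: "((real ^ 'k) \<times> (real ^ 'l)) set"
  shows "rational_on S (\<lambda>e. fst e $ p)" "rational_on S (\<lambda>e. snd e $ q)"
  by (intro rational_on.linear bounded_linear_compose[OF bounded_linear_vec_nth]
      bounded_linear_fst bounded_linear_snd)+

lemma smooth_atlas_GN: "smooth_atlas GN_topology (GN_atlas :: ('n::{finite,linorder} mat_vec, _) chart set)"
proof -
  have "smooth_on chart_domain (GN_chart \<circ> inv_into (carrier GN) GN_chart :: 'n chart_space \<Rightarrow> _)"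
    by (rule rational_imp_smooth_on[OF open_chart_domain])
      (rule rational_on.cong[OF rational_on_component(1)] rational_on.cong[OF rational_on_component(2)],
        simp add: inv_into_GN_chart del: GN_simps)+
  moreover have "homeomorphic_map GN_topology (top_of_set chart_domain) (GN_chart :: 'n mat_vec \<Rightarrow> _)"
    using homeomorphic_maps_GN_chart homeomorphic_map_maps by blast
  moreover have "openin GN_topology (carrier (GN :: 'n mat_vec monoid))"
    by (simp add: GN_topology_def del: GN_simps)
  moreover have "subtopology GN_topology (carrier (GN :: 'n mat_vec monoid)) = GN_topology"
    by (simp add: GN_topology_def subtopology_subtopology del: GN_simps)
  moreover have "topspace GN_topology = carrier (GN :: 'n mat_vec monoid)"
    by (simp add: GN_topology_def del: GN_simps)
  ultimately show ?thesis
    by (simp add: smooth_atlas_def GN_atlas_def GN_chart_image open_chart_domain del: GN_simps)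
qed

lemma second_countable_euclidean: "second_countable (euclidean :: 'a::second_countable_topology topology)"
proof -
  obtain B :: "'a set set" where B: "countable B" "\<And>S. open S \<Longrightarrow> \<exists>U. U \<subseteq> B \<and> S = \<Union>U" "\<And>C. C \<in> B \<Longrightarrow> open C"
    using univ_second_countable by metis
  moreover have "\<exists>V\<in>B. x \<in> V \<and> V \<subseteq> S" if S: "open S" "x \<in> S" for S x
  proof -
    obtain U where "U \<subseteq> B" "S = \<Union>U" using B(2) S(1) by blast
    with S(2) show ?thesis by blast
  qed
  ultimately show ?thesis
    unfolding second_countable_def by (intro exI[of _ B]) simp
qed

lemma smooth_manifold_GN: "smooth_manifold GN_topology (GN_atlas :: ('n::{finite,linorder} mat_vec, _) chart set)"
  unfolding smooth_manifold_def
proof (intro conjI smooth_atlas_GN)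
  show "Hausdorff_space (GN_topology :: 'n mat_vec topology)"
    unfolding GN_topology_def by (intro Hausdorff_space_subtopology Hausdorff_space_euclidean)
  show "second_countable (GN_topology :: 'n mat_vec topology)"
    unfolding GN_topology_def by (intro second_countable_subtopology second_countable_euclidean)
qed

lemma rational_on_unchart_entry:
  assumes "\<And>p. rational_on S (\<lambda>e. fst (h e) $ p)"
  shows "rational_on S (\<lambda>e. fst (unchart (h e)) $ i $ j)"
  by (cases "i \<le> j") (simp_all add: unchart_def assms rational_on.const)

lemma smooth_mult_GN:
  "smooth_map (prod_topology GN_topology GN_topology) (prod_atlas GN_atlas GN_atlas)
     GN_topology (GN_atlas :: ('n::{finite,linorder} mat_vec, _) chart set) (\<lambda>(x, y). x \<otimes>\<^bsub>GN\<^esub> y)"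
proof -
  interpret group "GN :: 'n mat_vec monoid" by (rule group_GN)
  let ?C = "carrier (GN :: 'n mat_vec monoid)"
  let ?D = "chart_domain :: 'n chart_space set"
  let ?m = "\<lambda>(x, y). x \<otimes>\<^bsub>GN\<^esub> y :: 'n mat_vec"
  have mC: "?m ` (?C \<times> ?C) \<subseteq> ?C"
    by (auto intro: m_closed simp del: GN_simps)
  have "continuous_on (?C \<times> ?C) ?m"
    unfolding GN_simps case_prod_unfold matrix_matrix_mult_def matrix_vector_mult_def
    by (intro continuous_intros)
  then have cont: "continuous_map (prod_topology GN_topology GN_topology) GN_topology ?m"
    using mC unfolding GN_topology_def prod_topology_subtopology_eu continuous_map_subtopology_eu
      image_subset_iff_funcset by blast
  have inj: "inj_on (map_prod GN_chart GN_chart) (?C \<times> ?C)"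
    by (intro map_prod_inj_on inj_on_GN_chart)
  have inv: "inv_into (?C \<times> ?C) (map_prod GN_chart GN_chart) e = (unchart (fst e), unchart (snd e))"
    if "e \<in> ?D \<times> ?D" for e
  proof (rule inv_into_f_eq[OF inj])
    show "(unchart (fst e), unchart (snd e)) \<in> ?C \<times> ?C"
      using that by (auto simp only: unchart_in_GN_iff mem_Times_iff fst_conv snd_conv)
  qed simp
  define f where "f = GN_chart \<circ> ?m \<circ> inv_into (?C \<times> ?C) (map_prod GN_chart GN_chart)"
  have f: "f e = GN_chart (unchart (fst e) \<otimes>\<^bsub>GN\<^esub> unchart (snd e))" if "e \<in> ?D \<times> ?D" for e
    using inv[OF that] by (simp add: f_def del: GN_simps)
  have lin: "rational_on (?D \<times> ?D) (\<lambda>e. fst (fst e) $ p)" "rational_on (?D \<times> ?D) (\<lambda>e. fst (snd e) $ p)"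
    "rational_on (?D \<times> ?D) (\<lambda>e. snd (fst e) $ i)" "rational_on (?D \<times> ?D) (\<lambda>e. snd (snd e) $ i)" for p i
    by (intro rational_on.linear bounded_linear_compose[OF bounded_linear_vec_nth]
      bounded_linear_compose[OF bounded_linear_fst] bounded_linear_compose[OF bounded_linear_snd]
      bounded_linear_fst bounded_linear_snd)+
  have "smooth_on (?D \<times> ?D) f"
  proof (rule rational_imp_smooth_on)
    show "open (?D \<times> ?D)" by (intro open_Times open_chart_domain)
  next
    fix p :: "'n upper_index"
    obtain i j where p: "i \<le> j" "p = upper i j" by (rule upper_index_cases)
    have "rational_on (?D \<times> ?D)
        (\<lambda>e. \<Sum>k\<in>UNIV. fst (unchart (fst e)) $ i $ k * fst (unchart (snd e)) $ k $ j)"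
      by (intro rational_on_sum rational_on.mult rational_on_unchart_entry lin)
    then show "rational_on (?D \<times> ?D) (\<lambda>e. fst (f e) $ p)"
      by (rule rational_on.cong) (simp only: f p GN_chart_upper GN_simps fst_conv matrix_mult_entry)
  next
    fix i :: 'n
    have "rational_on (?D \<times> ?D)
        (\<lambda>e. (\<Sum>k\<in>UNIV. fst (unchart (fst e)) $ i $ k * snd (snd e) $ k) + snd (fst e) $ i)"
      by (rule rational_on.add[OF rational_on_sum[OF rational_on.mult]])
        (intro rational_on_unchart_entry lin)+
    then show "rational_on (?D \<times> ?D) (\<lambda>e. snd (f e) $ i)"
      by (rule rational_on.cong)
        (simp only: f snd_GN_chart GN_simps snd_conv vector_add_component matrix_vector_entry,
          simp add: unchart_def)
  qed
  moreover have "map_prod GN_chart GN_chart ` ((?C \<times> ?C) \<inter> ?m -` ?C) = ?D \<times> ?D"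
  proof -
    have "(?C \<times> ?C) \<inter> ?m -` ?C = ?C \<times> ?C" using mC by blast
    then show ?thesis by (simp only: map_prod_surj_on[OF GN_chart_image GN_chart_image])
  qed
  ultimately show ?thesis
    using cont by (simp add: smooth_map_def f_def prod_atlas_def GN_atlas_def del: GN_simps)
qed

text \<open>
  Back substitution: the \<open>i\<close>-th row of \<open>A A\<^sup>-\<^sup>1 = 1\<close> expresses row \<open>i\<close> of the inverse by the rows below it, and
  the only denominator is the diagonal entry.
\<close>

lemma rational_on_matrix_inv_entry:
  "rational_on (chart_domain :: 'n::{finite,linorder} chart_space set)
     (\<lambda>e. matrix_inv (fst (unchart e)) $ i $ j)"
proof (induction i rule: decreasing_induct)
  case (1 i)
  let ?D = "chart_domain :: 'n chart_space set"
  let ?A = "\<lambda>e. fst (unchart e)"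
  have ent: "rational_on ?D (\<lambda>e. ?A e $ i $ k)" for k
    by (intro rational_on_unchart_entry rational_on_component)
  have ut: "upper_triangular_pos (?A e)" if "e \<in> ?D" for e
    using that unchart_in_GN_iff[of e] by simp
  have pos: "?A e $ i $ i \<noteq> 0" if "e \<in> ?D" for e
    using ut[OF that] unfolding upper_triangular_pos_def by (metis less_irrefl)
  have "rational_on ?D (\<lambda>e. ((if i = j then 1 else 0)
      - (\<Sum>k\<in>{i<..}. ?A e $ i $ k * matrix_inv (?A e) $ k $ j)) / ?A e $ i $ i)"
    using 1 pos
    by (intro rational_on_divide rational_on_diff rational_on_sum rational_on.mult rational_on.const ent) auto
  then show ?case
  proof (rule rational_on.cong)
    fix e assume e: "e \<in> ?D"
    have "(if i = j then 1 else 0) = (\<Sum>k\<in>UNIV. ?A e $ i $ k * matrix_inv (?A e) $ k $ j)"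
      using arg_cong[OF matrix_inv_mult_right[OF ut[OF e]], of "\<lambda>C. C $ i $ j"]
      by (simp add: matrix_mult_entry mat_def)
    also have "\<dots> = ?A e $ i $ i * matrix_inv (?A e) $ i $ j
        + (\<Sum>k\<in>{i<..}. ?A e $ i $ k * matrix_inv (?A e) $ k $ j)"
      by (rule upper_triangular_pos_sum_split[OF ut[OF e]])
    finally show "((if i = j then 1 else 0)
        - (\<Sum>k\<in>{i<..}. ?A e $ i $ k * matrix_inv (?A e) $ k $ j)) / ?A e $ i $ i
        = matrix_inv (?A e) $ i $ j"
      using pos[OF e] by (simp add: field_simps)
  qed
qed

lemma smooth_inv_GN:
  "smooth_map GN_topology GN_atlas
     GN_topology (GN_atlas :: ('n::{finite,linorder} mat_vec, _) chart set) (\<lambda>x. inv\<^bsub>GN\<^esub> x)"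
proof -
  interpret group "GN :: 'n mat_vec monoid" by (rule group_GN)
  let ?C = "carrier (GN :: 'n mat_vec monoid)"
  let ?D = "chart_domain :: 'n chart_space set"
  define f where "f = GN_chart \<circ> (\<lambda>x. inv\<^bsub>GN\<^esub> x) \<circ> inv_into ?C GN_chart"
  have f: "f e = GN_chart (inv\<^bsub>GN\<^esub> (unchart e))" if "e \<in> ?D" for e
    using that by (simp add: f_def inv_into_GN_chart del: GN_simps)
  have smooth: "smooth_on ?D f"
  proof (rule rational_imp_smooth_on[OF open_chart_domain])
    fix p :: "'n upper_index"
    obtain i j where p: "i \<le> j" "p = upper i j" by (rule upper_index_cases)
    show "rational_on ?D (\<lambda>e. fst (f e) $ p)"
      by (rule rational_on.cong[OF rational_on_matrix_inv_entry[of i j]])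
        (simp only: f p GN_chart_upper inv_GN unchart_in_GN_iff fst_conv)
  next
    fix i :: 'n
    have "rational_on ?D (\<lambda>e. - (\<Sum>k\<in>UNIV. matrix_inv (fst (unchart e)) $ i $ k * snd e $ k))"
      by (intro rational_on_minus rational_on_sum rational_on.mult rational_on_matrix_inv_entry
          rational_on_component)
    then show "rational_on ?D (\<lambda>e. snd (f e) $ i)"
      by (rule rational_on.cong)
        (simp only: f snd_GN_chart inv_GN unchart_in_GN_iff snd_conv vector_uminus_component
            matrix_vector_entry, simp add: unchart_def)
  qed
  have "continuous_on ?D f"
    using smooth unfolding smooth_on_def by (metis Ck_on.simps(1))
  then have "continuous_on ?C (\<lambda>x. unchart (f (GN_chart x)))"
    by (rule continuous_on_compose2[OF continuous_on_unchart[of UNIV]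
          continuous_on_compose2[OF _ continuous_on_GN_chart]])
      (simp_all only: GN_chart_image order_refl subset_UNIV)
  moreover have "unchart (f (GN_chart x)) = inv\<^bsub>GN\<^esub> x" if "x \<in> ?C" for x
  proof -
    have "GN_chart x \<in> ?D" using that GN_chart_image by blast
    then show ?thesis using that by (simp only: f unchart_GN_chart inv_closed)
  qed
  ultimately have "continuous_on ?C (\<lambda>x. inv\<^bsub>GN\<^esub> x)"
    by (rule continuous_on_eq)
  then have cont: "continuous_map GN_topology GN_topology (\<lambda>x::'n mat_vec. inv\<^bsub>GN\<^esub> x)"
    unfolding GN_topology_def continuous_map_subtopology_eu by (intro conjI Pi_I inv_closed)
  have "?C \<inter> (\<lambda>x. inv\<^bsub>GN\<^esub> x) -` ?C = ?C"
    using inv_closed by blast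
  then show ?thesis
    using cont smooth by (simp add: smooth_map_def f_def GN_atlas_def GN_chart_image del: GN_simps)
qed

theorem lie_group_GN: "lie_group (GN :: 'n::{finite,linorder} mat_vec monoid) GN_topology GN_atlas"
  unfolding lie_group_def
proof (intro conjI group_GN smooth_manifold_GN smooth_mult_GN smooth_inv_GN)
  show "topspace GN_topology = carrier (GN :: 'n mat_vec monoid)"
    by (simp add: GN_topology_def del: GN_simps)
qed


section \<open>Triangular maps preserving Lebesgue measure\<close>

lemma nn_integral_lborel_translate:
  fixes f :: "'e::euclidean_space \<Rightarrow> ennreal"
  assumes [measurable]: "f \<in> borel_measurable borel"
  shows "(\<integral>\<^sup>+x. f (c + x) \<partial>lborel) = (\<integral>\<^sup>+x. f x \<partial>lborel)"
proof -
  have "(\<integral>\<^sup>+x. f x \<partial>lborel) = (\<integral>\<^sup>+x. f x \<partial>distr lborel borel ((+) c))"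
    by (simp add: lborel_distr_plus)
  also have "\<dots> = (\<integral>\<^sup>+x. f (c + x) \<partial>lborel)"
    by (subst nn_integral_distr) auto
  finally show ?thesis by simp
qed

text \<open>
  The right-hand side does not involve \<open>\<phi>\<close>, so the integral is the same as for \<open>\<phi> = 0\<close>. To arrive there,
  insert the factor \<open>1 = \<integral> w (x \<bullet> b + s) ds\<close> with \<open>w\<close> the indicator of the unit interval, exchange the integrals,
  translate \<open>x\<close> by \<open>- s b\<close>, which leaves \<open>\<phi> x\<close> unchanged, exchange again, and absorb \<open>\<phi> x\<close> into \<open>s\<close>.
\<close>

lemma nn_integral_lborel_shear:
  fixes f :: "'e::euclidean_space \<Rightarrow> ennreal" and \<phi> :: "'e \<Rightarrow> real"
  assumes [measurable]: "f \<in> borel_measurable borel" "\<phi> \<in> borel_measurable borel"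
    and b: "b \<in> Basis" and inv: "\<And>x s. \<phi> (x + s *\<^sub>R b) = \<phi> x"
  shows "(\<integral>\<^sup>+x. f (x + \<phi> x *\<^sub>R b) \<partial>lborel) =
    (\<integral>\<^sup>+x. indicator {0..1} (x \<bullet> b) * (\<integral>\<^sup>+s. f (x + s *\<^sub>R b) \<partial>lborel) \<partial>lborel)"
proof -
  let ?w = "indicator {0..1::real} :: real \<Rightarrow> ennreal"
  have w: "(\<integral>\<^sup>+s. ?w (x \<bullet> b + s) \<partial>lborel) = 1" for x :: 'e
    by (subst nn_integral_lborel_translate) simp_all
  have bb: "b \<bullet> b = 1" using b by simp
  have "(\<integral>\<^sup>+x. f (x + \<phi> x *\<^sub>R b) \<partial>lborel) =
      (\<integral>\<^sup>+x. (\<integral>\<^sup>+s. ?w (x \<bullet> b + s) * f (x + \<phi> x *\<^sub>R b) \<partial>lborel) \<partial>lborel)"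
    by (subst nn_integral_multc) (simp_all add: w)
  also have "\<dots> = (\<integral>\<^sup>+s. (\<integral>\<^sup>+x. ?w (x \<bullet> b + s) * f (x + \<phi> x *\<^sub>R b) \<partial>lborel) \<partial>lborel)"
    by (rule lborel_pair.Fubini') measurable
  also have "\<dots> = (\<integral>\<^sup>+s. (\<integral>\<^sup>+x. ?w (x \<bullet> b) * f (x + (\<phi> x - s) *\<^sub>R b) \<partial>lborel) \<partial>lborel)"
  proof (rule nn_integral_cong)
    fix s :: real
    have "(\<integral>\<^sup>+x. ?w (x \<bullet> b + s) * f (x + \<phi> x *\<^sub>R b) \<partial>lborel) =
      (\<integral>\<^sup>+x. ?w ((- s *\<^sub>R b + x) \<bullet> b + s) * f ((- s *\<^sub>R b + x) + \<phi> (- s *\<^sub>R b + x) *\<^sub>R b) \<partial>lborel)"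
      by (subst nn_integral_lborel_translate
            [where f = "\<lambda>x. ?w (x \<bullet> b + s) * f (x + \<phi> x *\<^sub>R b)"]) simp_all
    moreover have "\<phi> (- s *\<^sub>R b + x) = \<phi> x" for x
      using inv[of x "- s"] by (simp add: add.commute)
    ultimately show "(\<integral>\<^sup>+x. ?w (x \<bullet> b + s) * f (x + \<phi> x *\<^sub>R b) \<partial>lborel) =
        (\<integral>\<^sup>+x. ?w (x \<bullet> b) * f (x + (\<phi> x - s) *\<^sub>R b) \<partial>lborel)"
      by (simp add: inner_add_left bb algebra_simps)
  qed
  also have "\<dots> = (\<integral>\<^sup>+x. (\<integral>\<^sup>+s. ?w (x \<bullet> b) * f (x + (\<phi> x - s) *\<^sub>R b) \<partial>lborel) \<partial>lborel)"
    by (rule lborel_pair.Fubini') measurable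
  also have "\<dots> = (\<integral>\<^sup>+x. ?w (x \<bullet> b) * (\<integral>\<^sup>+s. f (x + (\<phi> x - s) *\<^sub>R b) \<partial>lborel) \<partial>lborel)"
    by (subst nn_integral_cmult) simp_all
  also have "\<dots> = (\<integral>\<^sup>+x. ?w (x \<bullet> b) * (\<integral>\<^sup>+s. f (x + s *\<^sub>R b) \<partial>lborel) \<partial>lborel)"
  proof (rule nn_integral_cong)
    fix x
    show "?w (x \<bullet> b) * (\<integral>\<^sup>+s. f (x + (\<phi> x - s) *\<^sub>R b) \<partial>lborel) =
        ?w (x \<bullet> b) * (\<integral>\<^sup>+s. f (x + s *\<^sub>R b) \<partial>lborel)"
      using nn_integral_real_affine[of "\<lambda>s. f (x + s *\<^sub>R b)" "-1" "\<phi> x"] by simp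
  qed
  finally show ?thesis .
qed

lemma distr_lborel_shear:
  fixes \<phi> :: "'e::euclidean_space \<Rightarrow> real"
  assumes [measurable]: "\<phi> \<in> borel_measurable borel"
    and b: "b \<in> Basis" and inv: "\<And>x s. \<phi> (x + s *\<^sub>R b) = \<phi> x"
  shows "distr lborel borel (\<lambda>x. x + \<phi> x *\<^sub>R b) = lborel"
proof (rule measure_eqI)
  fix A assume "A \<in> sets (distr lborel borel (\<lambda>x. x + \<phi> x *\<^sub>R b))"
  then have [measurable]: "A \<in> sets borel" by simp
  let ?f = "indicator A :: 'e \<Rightarrow> ennreal"
  have "emeasure (distr lborel borel (\<lambda>x. x + \<phi> x *\<^sub>R b)) A =
      (\<integral>\<^sup>+x. ?f x \<partial>distr lborel borel (\<lambda>x. x + \<phi> x *\<^sub>R b))"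
    by simp
  also have "\<dots> = (\<integral>\<^sup>+x. ?f (x + \<phi> x *\<^sub>R b) \<partial>lborel)"
    by (subst nn_integral_distr) simp_all
  also have "\<dots> = (\<integral>\<^sup>+x. ?f (x + (\<lambda>_. 0) x *\<^sub>R b) \<partial>lborel)"
    using nn_integral_lborel_shear[of ?f \<phi> b] nn_integral_lborel_shear[of ?f "\<lambda>_. 0" b] b inv
    by simp
  also have "\<dots> = emeasure lborel A"
    by simp
  finally show "emeasure (distr lborel borel (\<lambda>x. x + \<phi> x *\<^sub>R b)) A = emeasure lborel A" .
qed simp

text \<open>
  The map is a composition of shears, one for each coordinate. If they are added in the order of increasing
  \<open>h\<close>, a new shear changes a coordinate that none of the displacements collected so far depends on, so it can
  be applied first without affecting them.
\<close>

lemma distr_lborel_triangular: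
  fixes T :: "'e::euclidean_space \<Rightarrow> 'e" and h :: "'e \<Rightarrow> nat"
  assumes [measurable]: "T \<in> borel_measurable borel"
    and tri: "\<And>b x y. b \<in> Basis \<Longrightarrow> (\<And>c. c \<in> Basis \<Longrightarrow> h c < h b \<Longrightarrow> x \<bullet> c = y \<bullet> c) \<Longrightarrow>
      (T x - x) \<bullet> b = (T y - y) \<bullet> b"
  shows "distr lborel borel T = lborel"
proof -
  define T' where "T' = (\<lambda>B x. x + (\<Sum>b\<in>B. ((T x - x) \<bullet> b) *\<^sub>R b))"
  have meas [measurable]: "T' B \<in> borel_measurable borel" for B
    unfolding T'_def by measurable
  have "B \<subseteq> Basis \<longrightarrow> distr lborel borel (T' B) = lborel" if "finite B" for B
    using that
  proof (induction B rule: finite_ranking_induct[where f = h])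
    case empty
    then show ?case by (simp add: T'_def distr_id2)
  next
    case (insert c B)
    show ?case
    proof (cases "c \<in> B")
      case True
      then show ?thesis using insert by (simp add: insert_absorb)
    next
      case False
      show ?thesis
      proof
        assume sub: "insert c B \<subseteq> Basis"
        then have c: "c \<in> Basis" by simp
        define \<phi> where "\<phi> = (\<lambda>x. (T x - x) \<bullet> c)"
        have [measurable]: "\<phi> \<in> borel_measurable borel"
          unfolding \<phi>_def by measurable
        have indep: "(T (x + s *\<^sub>R c) - (x + s *\<^sub>R c)) \<bullet> b = (T x - x) \<bullet> b"
          if "b \<in> insert c B" for b x s
        proof (rule tri)
          show "b \<in> Basis" using that sub by auto
          fix d assume "d \<in> Basis" "h d < h b"
          moreover have "h b \<le> h c" using that insert by auto
          ultimately show "(x + s *\<^sub>R c) \<bullet> d = x \<bullet> d"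
            using c by (auto simp: inner_add_left inner_Basis)
        qed
        have "T' (insert c B) = T' B \<circ> (\<lambda>x. x + \<phi> x *\<^sub>R c)"
        proof
          fix x
          have "(\<Sum>b\<in>B. ((T (x + \<phi> x *\<^sub>R c) - (x + \<phi> x *\<^sub>R c)) \<bullet> b) *\<^sub>R b)
              = (\<Sum>b\<in>B. ((T x - x) \<bullet> b) *\<^sub>R b)"
            by (rule sum.cong) (simp_all add: indep)
          then show "T' (insert c B) x = (T' B \<circ> (\<lambda>x. x + \<phi> x *\<^sub>R c)) x"
            using False insert.hyps(1) by (simp add: T'_def \<phi>_def)
        qed
        then have "distr lborel borel (T' (insert c B)) =
            distr (distr lborel borel (\<lambda>x. x + \<phi> x *\<^sub>R c)) borel (T' B)"
          by (subst distr_distr) simp_all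
        also have "distr lborel borel (\<lambda>x. x + \<phi> x *\<^sub>R c) = lborel"
          by (rule distr_lborel_shear) (simp_all add: c, simp add: \<phi>_def indep)
        finally show "distr lborel borel (T' (insert c B)) = lborel"
          using insert sub by simp
      qed
    qed
  qed
  moreover have "T' Basis = T"
    by (auto simp: T'_def euclidean_representation)
  ultimately show ?thesis
    by (metis finite_Basis order_refl)
qed


section \<open>Lebesgue measure in global Euclidean coordinates\<close>

text \<open>
  A space with one global chart onto a full Euclidean space. Lebesgue measure is transported to it, and
  regularity, finiteness on compact sets and \<open>\<sigma>\<close>-compactness come along.
\<close>

locale euclidean_coordinates =
  fixes X :: "'a topology" and \<phi> :: "'a \<Rightarrow> 'e::euclidean_space" and \<psi> :: "'e \<Rightarrow> 'a"
  assumes homeo: "homeomorphic_maps X euclidean \<phi> \<psi>"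
begin

definition borel_of_space :: "'a measure" where
  "borel_of_space = sigma (topspace X) {U. openin X U}"

definition lebesgue_of_space :: "'a measure" where
  "lebesgue_of_space = distr lborel borel_of_space \<psi>"

lemma opens_subset_Pow: "{U. openin X U} \<subseteq> Pow (topspace X)"
  using openin_subset by blast

lemma space_borel_of_space [simp]: "space borel_of_space = topspace X"
  by (simp add: borel_of_space_def space_measure_of opens_subset_Pow)

lemma sets_borel_of_space: "sets borel_of_space = sigma_sets (topspace X) {U. openin X U}"
  by (simp add: borel_of_space_def sets_measure_of opens_subset_Pow)

lemma space_lebesgue_of_space [simp]: "space lebesgue_of_space = topspace X"
  and sets_lebesgue_of_space [simp, measurable_cong]: "sets lebesgue_of_space = sets borel_of_space"
  by (simp_all add: lebesgue_of_space_def)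

lemma openin_sets [intro]: "openin X U \<Longrightarrow> U \<in> sets borel_of_space"
  by (auto simp: sets_borel_of_space)

lemma \<psi>_in [simp]: "\<psi> e \<in> topspace X"
  and \<phi>_\<psi> [simp]: "\<phi> (\<psi> e) = e"
  and \<psi>_\<phi>: "x \<in> topspace X \<Longrightarrow> \<psi> (\<phi> x) = x"
  using homeo unfolding homeomorphic_maps_def continuous_map_def by auto

lemma continuous_\<phi>: "continuous_map X euclidean \<phi>" and continuous_\<psi>: "continuous_map euclidean X \<psi>"
  using homeo unfolding homeomorphic_maps_def by auto

lemma measurable_\<psi> [measurable]: "\<psi> \<in> measurable borel borel_of_space"
  unfolding borel_of_space_def
proof (rule measurable_measure_of)
  show "{U. openin X U} \<subseteq> Pow (topspace X)" by (rule opens_subset_Pow)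
  show "\<psi> \<in> space borel \<rightarrow> topspace X" by simp
  fix U assume "U \<in> {U. openin X U}"
  then have "open {e \<in> UNIV. \<psi> e \<in> U}"
    using openin_continuous_map_preimage[OF continuous_\<psi>] by simp
  then show "\<psi> -` U \<inter> space borel \<in> sets borel"
    by (simp add: vimage_def)
qed

lemma measurable_\<phi> [measurable]: "\<phi> \<in> measurable borel_of_space borel"
proof (rule borel_measurableI)
  fix S :: "'e set" assume "open S"
  then have "openin X {x \<in> topspace X. \<phi> x \<in> S}"
    using openin_continuous_map_preimage[OF continuous_\<phi>] by simp
  then show "\<phi> -` S \<inter> space borel_of_space \<in> sets borel_of_space"
    by (simp add: vimage_def Int_def conj_commute openin_sets)
qed

lemma measurable_continuous_map:
  assumes "continuous_map X X f"
  shows "f \<in> measurable borel_of_space borel_of_space"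
proof -
  have "f \<in> measurable borel_of_space (sigma (topspace X) {U. openin X U})"
  proof (rule measurable_measure_of)
    show "{U. openin X U} \<subseteq> Pow (topspace X)" by (rule opens_subset_Pow)
    show "f \<in> space borel_of_space \<rightarrow> topspace X"
      using assms continuous_map_funspace by simp
    fix U assume "U \<in> {U. openin X U}"
    then have "openin X {x \<in> topspace X. f x \<in> U}"
      using openin_continuous_map_preimage[OF assms] by simp
    then show "f -` U \<inter> space borel_of_space \<in> sets borel_of_space"
      by (simp add: vimage_def Int_def conj_commute openin_sets)
  qed
  then show ?thesis by (simp add: borel_of_space_def)
qed

lemma emeasure_lebesgue_of_space:
  "B \<in> sets borel_of_space \<Longrightarrow> emeasure lebesgue_of_space B = emeasure lborel (\<psi> -` B)"
  by (simp add: lebesgue_of_space_def emeasure_distr)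

lemma vimage_\<psi>: "B \<subseteq> topspace X \<Longrightarrow> \<psi> -` B = \<phi> ` B"
  using \<psi>_\<phi> by (force simp: image_iff)

lemma image_\<psi>: "\<psi> ` A = \<phi> -` A \<inter> topspace X"
  using \<psi>_\<phi> by (force simp: image_iff)

lemma vimage_image_\<psi>: "\<psi> -` (\<psi> ` A) = A"
  by (auto simp: image_\<psi>)

lemma image_\<psi>_sets: "A \<in> sets borel \<Longrightarrow> \<psi> ` A \<in> sets borel_of_space"
  using measurable_sets[OF measurable_\<phi>] by (simp add: image_\<psi>)

lemma openin_image_\<psi>: "open A \<Longrightarrow> openin X (\<psi> ` A)"
  using openin_continuous_map_preimage[OF continuous_\<phi>, of A]
  by (simp add: image_\<psi> vimage_def Int_def conj_commute)

lemma compactin_image_\<psi>: "compact A \<Longrightarrow> compactin X (\<psi> ` A)"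
  using image_compactin[OF _ continuous_\<psi>] by simp

lemma lebesgue_of_space_nonzero: "emeasure lebesgue_of_space (topspace X) \<noteq> 0"
proof -
  have "\<psi> -` topspace X = UNIV" by auto
  then show ?thesis
    by (simp add: emeasure_lebesgue_of_space openin_sets)
qed

lemma lebesgue_of_space_compact:
  assumes "compactin X K"
  shows "emeasure lebesgue_of_space K < \<infinity>"
proof (cases "K \<in> sets borel_of_space")
  case True
  have "compact (\<phi> ` K)"
    using image_compactin[OF assms continuous_\<phi>] by simp
  then show ?thesis
    using True compactin_subset_topspace[OF assms] emeasure_compact_finite[of "\<phi> ` K"]
    by (simp add: emeasure_lebesgue_of_space vimage_\<psi>)
next
  case False
  then show ?thesis by (simp add: emeasure_notin_sets)
qed

lemma lebesgue_of_space_outer_regular: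
  assumes B: "B \<in> sets borel_of_space"
  shows "emeasure lebesgue_of_space B = (INF U\<in>{U. openin X U \<and> B \<subseteq> U}. emeasure lebesgue_of_space U)"
proof (rule antisym)
  show "emeasure lebesgue_of_space B \<le> (INF U\<in>{U. openin X U \<and> B \<subseteq> U}. emeasure lebesgue_of_space U)"
    by (rule INF_greatest) (auto intro!: emeasure_mono)
  show "(INF U\<in>{U. openin X U \<and> B \<subseteq> U}. emeasure lebesgue_of_space U) \<le> emeasure lebesgue_of_space B"
  proof (rule ennreal_le_epsilon)
    fix e :: real assume "0 < e"
    have \<psi>B: "\<psi> -` B \<in> sets borel"
      using measurable_sets[OF measurable_\<psi> B] by simp
    obtain U where U: "open U" "\<psi> -` B \<subseteq> U" "emeasure lborel (U - \<psi> -` B) < e"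
      using outer_regular_lborel[OF \<psi>B \<open>0 < e\<close>] .
    have "B \<subseteq> \<psi> ` U"
      using U(2) sets.sets_into_space[OF B] \<psi>_\<phi> by (force simp: image_\<psi>)
    then have "(INF U\<in>{U. openin X U \<and> B \<subseteq> U}. emeasure lebesgue_of_space U)
        \<le> emeasure lebesgue_of_space (\<psi> ` U)"
      using openin_image_\<psi>[OF U(1)] by (intro INF_lower) simp
    also have "\<dots> = emeasure lborel U"
      using U(1) by (simp add: emeasure_lebesgue_of_space image_\<psi>_sets vimage_image_\<psi>)
    also have "U = \<psi> -` B \<union> (U - \<psi> -` B)" using U(2) by blast
    also have "emeasure lborel \<dots> \<le> emeasure lborel (\<psi> -` B) + emeasure lborel (U - \<psi> -` B)"
      using \<psi>B U(1) by (intro emeasure_subadditive) auto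
    also have "\<dots> \<le> emeasure lebesgue_of_space B + ennreal e"
      using U(3) B by (intro add_mono) (simp_all add: emeasure_lebesgue_of_space)
    finally show "(INF U\<in>{U. openin X U \<and> B \<subseteq> U}. emeasure lebesgue_of_space U)
        \<le> emeasure lebesgue_of_space B + ennreal e" .
  qed
qed

lemma lebesgue_of_space_inner_regular:
  assumes U: "openin X U"
  shows "emeasure lebesgue_of_space U = (SUP K\<in>{K. compactin X K \<and> K \<subseteq> U}. emeasure lebesgue_of_space K)"
proof (rule antisym)
  show "(SUP K\<in>{K. compactin X K \<and> K \<subseteq> U}. emeasure lebesgue_of_space K) \<le> emeasure lebesgue_of_space U"
    using U by (intro SUP_least emeasure_mono) auto
  have "open (\<psi> -` U)"
    using openin_continuous_map_preimage[OF continuous_\<psi> U] by (simp add: vimage_def)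
  then obtain C where C: "\<And>n. compact (C n)" "\<And>n. C n \<subseteq> \<psi> -` U"
      "\<And>n. C n \<subseteq> interior (C (Suc n))" "\<Union>(range C) = \<psi> -` U"
    by (rule open_Union_compact_subsets) blast
  have "incseq C"
    using C(3) interior_subset by (intro incseq_SucI) blast
  then have "emeasure lborel (\<psi> -` U) = (SUP n. emeasure lborel (C n))"
    unfolding C(4)[symmetric] using C(1)
    by (intro SUP_emeasure_incseq[symmetric]) (auto intro: compact_imp_closed borel_closed)
  also have "\<dots> \<le> (SUP K\<in>{K. compactin X K \<and> K \<subseteq> U}. emeasure lebesgue_of_space K)"
  proof (rule SUP_least)
    fix n
    have "\<psi> ` C n \<in> sets borel_of_space"
      by (intro image_\<psi>_sets borel_closed compact_imp_closed C)
    then have "emeasure lborel (C n) = emeasure lebesgue_of_space (\<psi> ` C n)"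
      by (simp add: emeasure_lebesgue_of_space vimage_image_\<psi>)
    also have "\<dots> \<le> (SUP K\<in>{K. compactin X K \<and> K \<subseteq> U}. emeasure lebesgue_of_space K)"
      using C(2)[of n] by (intro SUP_upper) (auto intro: compactin_image_\<psi> C(1))
    finally show "emeasure lborel (C n)
        \<le> (SUP K\<in>{K. compactin X K \<and> K \<subseteq> U}. emeasure lebesgue_of_space K)" .
  qed
  finally show "emeasure lebesgue_of_space U
      \<le> (SUP K\<in>{K. compactin X K \<and> K \<subseteq> U}. emeasure lebesgue_of_space K)"
    using U by (simp add: emeasure_lebesgue_of_space openin_sets)
qed

text \<open>
  The space is the union of countably many compact sets, the images of the balls of integer radius.
\<close>

lemma loc_AE_iff_AE: "loc_AE X lebesgue_of_space Q \<longleftrightarrow> (AE x in lebesgue_of_space. Q x)"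
proof
  assume Q: "loc_AE X lebesgue_of_space Q"
  have "AE x in lebesgue_of_space. x \<in> \<psi> ` cball 0 (real n) \<longrightarrow> Q x" for n
    using Q compactin_image_\<psi>[of "cball 0 (real n)"] by (simp add: loc_AE_def)
  then have "AE x in lebesgue_of_space. \<forall>n. x \<in> \<psi> ` cball 0 (real n) \<longrightarrow> Q x"
    by (intro AE_all_countable[THEN iffD2] allI)
  then show "AE x in lebesgue_of_space. Q x"
  proof (rule AE_mp, intro AE_I2 impI)
    fix x assume x: "x \<in> space lebesgue_of_space" "\<forall>n. x \<in> \<psi> ` cball 0 (real n) \<longrightarrow> Q x"
    obtain n where "norm (\<phi> x) \<le> real n" using real_arch_simple by blast
    then have "x \<in> \<psi> ` cball 0 (real n)" using x(1) by (simp add: image_\<psi>)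
    then show "Q x" using x(2) by blast
  qed
qed (auto simp: loc_AE_def)

lemma order_unit_Linfty:
  "order_unit_function_space (Linfty X lebesgue_of_space) (\<lambda>f. loc_AE X lebesgue_of_space (\<lambda>x. 0 \<le> f x))"
proof
  show "(\<lambda>x. 1) \<in> Linfty X lebesgue_of_space"
    by (auto simp: Linfty_def loc_AE_iff_AE)
next
  fix f h assume "f \<in> Linfty X lebesgue_of_space" "h \<in> Linfty X lebesgue_of_space"
  then obtain C D where [measurable]: "f \<in> borel_measurable lebesgue_of_space" "h \<in> borel_measurable lebesgue_of_space"
    and "AE x in lebesgue_of_space. \<bar>f x\<bar> \<le> C" "AE x in lebesgue_of_space. \<bar>h x\<bar> \<le> D"
    by (auto simp: Linfty_def loc_AE_iff_AE)
  moreover from this(3,4) have "AE x in lebesgue_of_space. \<bar>f x + h x\<bar> \<le> C + D"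
    by eventually_elim linarith
  ultimately show "(\<lambda>x. f x + h x) \<in> Linfty X lebesgue_of_space"
    by (auto simp: Linfty_def loc_AE_iff_AE)
next
  fix f and c :: real assume "f \<in> Linfty X lebesgue_of_space"
  then obtain C where [measurable]: "f \<in> borel_measurable lebesgue_of_space"
    and "AE x in lebesgue_of_space. \<bar>f x\<bar> \<le> C"
    by (auto simp: Linfty_def loc_AE_iff_AE)
  moreover from this(2) have "AE x in lebesgue_of_space. \<bar>c * f x\<bar> \<le> \<bar>c\<bar> * C"
    by eventually_elim (simp add: abs_mult mult_left_mono)
  ultimately show "(\<lambda>x. c * f x) \<in> Linfty X lebesgue_of_space"
    by (auto simp: Linfty_def loc_AE_iff_AE)
next
  fix f assume "f \<in> Linfty X lebesgue_of_space"
  then obtain C where C: "AE x in lebesgue_of_space. \<bar>f x\<bar> \<le> C"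
    by (auto simp: Linfty_def loc_AE_iff_AE)
  from C have "AE x in lebesgue_of_space. 0 \<le> C - f x" "AE x in lebesgue_of_space. 0 \<le> C + f x"
    by (eventually_elim, linarith)+
  then show "\<exists>C. loc_AE X lebesgue_of_space (\<lambda>x. 0 \<le> C - f x) \<and> loc_AE X lebesgue_of_space (\<lambda>x. 0 \<le> C + f x)"
    by (auto simp: loc_AE_iff_AE)
qed

lemma AE_lborel_coordinates: "AE x in lebesgue_of_space. Q x \<Longrightarrow> AE e in lborel. Q (\<psi> e)"
  unfolding lebesgue_of_space_def by (rule AE_distrD[OF _]) simp_all

text \<open>
  A starting point for producing invariant means: the average over the unit cube of the coordinate space.
\<close>

lemma mean_on_Linfty_exists:
  "\<exists>M. mean_on (Linfty X lebesgue_of_space) (\<lambda>f. loc_AE X lebesgue_of_space (\<lambda>x. 0 \<le> f x)) M"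
proof (intro exI)
  let ?I = "cbox 0 One :: 'e set"
  let ?M = "\<lambda>f::'a \<Rightarrow> real. LINT e:?I|lborel. f (\<psi> e)"
  have int: "set_integrable lborel ?I (\<lambda>e. f (\<psi> e))" if f: "f \<in> Linfty X lebesgue_of_space" for f
  proof -
    from f obtain C where meas: "f \<in> borel_measurable lebesgue_of_space"
      and "AE x in lebesgue_of_space. \<bar>f x\<bar> \<le> C"
      by (auto simp: Linfty_def loc_AE_iff_AE)
    then have C: "AE e in lborel. \<bar>f (\<psi> e)\<bar> \<le> C"
      by (intro AE_lborel_coordinates)
    from meas have [measurable]: "f \<in> borel_measurable borel_of_space" by measurable
    have bound: "integrable lborel (\<lambda>e. indicator ?I e *\<^sub>R C)"
      by (intro integrable_scaleR_left integrable_real_indicator) (simp_all add: emeasure_bounded_finite)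
    have le: "AE e in lborel. norm (indicator ?I e *\<^sub>R f (\<psi> e)) \<le> norm (indicator ?I e *\<^sub>R C)"
      using C by eventually_elim (auto simp: indicator_def)
    show ?thesis
      unfolding set_integrable_def
      by (rule Bochner_Integration.integrable_bound[OF bound _ le]) measurable
  qed
  show "mean_on (Linfty X lebesgue_of_space) (\<lambda>f. loc_AE X lebesgue_of_space (\<lambda>x. 0 \<le> f x)) ?M"
    unfolding mean_on_def
  proof (intro conjI ballI allI impI)
    fix f h assume "f \<in> Linfty X lebesgue_of_space" "h \<in> Linfty X lebesgue_of_space"
    then show "?M (\<lambda>x. f x + h x) = ?M f + ?M h" by (intro set_integral_add int)
  next
    fix c f show "?M (\<lambda>x. c * f x) = c * ?M f" by simp
  next
    fix f :: "'a \<Rightarrow> real" assume "loc_AE X lebesgue_of_space (\<lambda>x. 0 \<le> f x)"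
    then have "AE e in lborel. 0 \<le> f (\<psi> e)"
      unfolding loc_AE_iff_AE by (rule AE_lborel_coordinates)
    then show "0 \<le> ?M f"
      unfolding set_lebesgue_integral_def
      by (intro integral_nonneg_AE) (auto elim!: eventually_mono)
  next
    show "?M (\<lambda>x. 1) = 1"
      by (simp add: set_lebesgue_integral_def)
  qed
qed

lemma distr_lebesgue_of_space:
  assumes f: "continuous_map X X f" and inv: "distr lborel borel (\<phi> \<circ> f \<circ> \<psi>) = lborel"
  shows "distr lebesgue_of_space lebesgue_of_space f = lebesgue_of_space"
proof -
  note [measurable] = measurable_continuous_map[OF f]
  have fX: "f (\<psi> e) \<in> topspace X" for e
    using f continuous_map_funspace by fastforce
  have "distr lebesgue_of_space lebesgue_of_space f = distr lebesgue_of_space borel_of_space f"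
    by (rule distr_cong) simp_all
  also have "\<dots> = distr lborel borel_of_space (f \<circ> \<psi>)"
    unfolding lebesgue_of_space_def by (subst distr_distr) simp_all
  also have "f \<circ> \<psi> = \<psi> \<circ> (\<phi> \<circ> f \<circ> \<psi>)"
    by (simp add: fun_eq_iff \<psi>_\<phi> fX)
  also have "distr lborel borel_of_space (\<psi> \<circ> (\<phi> \<circ> f \<circ> \<psi>)) =
      distr (distr lborel borel (\<phi> \<circ> f \<circ> \<psi>)) borel_of_space \<psi>"
    by (subst distr_distr) (simp_all add: comp_def)
  finally show ?thesis by (simp add: inv lebesgue_of_space_def)
qed

end


section \<open>Haar measure in logarithmic coordinates\<close>

text \<open>
  The coordinates of the factorisation \<open>(V, m) = a n\<close> into a diagonal and a unipotent element: the logarithms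
  of the diagonal of \<open>a\<close> and the entries of \<open>n\<close>. With the diagonal factor on the left, left Haar measure has
  constant density in these coordinates.
\<close>

definition log_coordinates :: "'n::{finite,linorder} mat_vec \<Rightarrow> 'n chart_space" where
  "log_coordinates x =
    (\<chi> p. let i = fst (Rep_upper_index p); j = snd (Rep_upper_index p) in
       if i = j then ln (fst x $ i $ i) else fst x $ i $ j / fst x $ i $ i,
     \<chi> i. snd x $ i / fst x $ i $ i)"

definition exp_coordinates :: "'n::{finite,linorder} chart_space \<Rightarrow> 'n mat_vec" where
  "exp_coordinates e =
    (\<chi> i j. if i = j then exp (fst e $ upper i i)
       else if i < j then exp (fst e $ upper i i) * fst e $ upper i j else 0,
     \<chi> i. exp (fst e $ upper i i) * snd e $ i)"

lemma log_coordinates_simps [simp]: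
  "fst (log_coordinates x) $ upper i i = ln (fst x $ i $ i)"
  "i < j \<Longrightarrow> fst (log_coordinates x) $ upper i j = fst x $ i $ j / fst x $ i $ i"
  "snd (log_coordinates x) $ i = snd x $ i / fst x $ i $ i"
  by (simp_all add: log_coordinates_def)

lemma exp_coordinates_simps [simp]:
  "fst (exp_coordinates e) $ i $ i = exp (fst e $ upper i i)"
  "i < j \<Longrightarrow> fst (exp_coordinates e) $ i $ j = exp (fst e $ upper i i) * fst e $ upper i j"
  "j < i \<Longrightarrow> fst (exp_coordinates e) $ i $ j = 0"
  "snd (exp_coordinates e) $ i = exp (fst e $ upper i i) * snd e $ i"
  by (auto simp: exp_coordinates_def)

lemma exp_coordinates_in_GN: "exp_coordinates e \<in> carrier GN"
  by (simp add: upper_triangular_pos_def)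

lemma log_exp_coordinates: "log_coordinates (exp_coordinates e) = e"
proof (rule chart_space_eqI)
  fix i j :: 'a assume "i \<le> j"
  then show "fst (log_coordinates (exp_coordinates e)) $ upper i j = fst e $ upper i j"
    by (cases "i = j") simp_all
qed (simp add: vec_eq_iff)

lemma exp_log_coordinates:
  assumes "x \<in> carrier GN"
  shows "exp_coordinates (log_coordinates x) = x"
proof -
  have diag: "0 < fst x $ i $ i" and low: "j < i \<Longrightarrow> fst x $ i $ j = 0" for i j
    using assms by (auto simp: upper_triangular_pos_def)
  have "fst (exp_coordinates (log_coordinates x)) $ i $ j = fst x $ i $ j" for i j
    using diag[of i] low[of j i] by (cases i j rule: linorder_cases) simp_all
  moreover have "snd (exp_coordinates (log_coordinates x)) $ i = snd x $ i" for i
    using diag[of i] by simp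
  ultimately show ?thesis by (simp add: prod_eq_iff vec_eq_iff)
qed

lemma continuous_on_exp_coordinates: "continuous_on A exp_coordinates"
proof -
  have "continuous_on A (\<lambda>e. if i = j then exp (fst e $ upper i i)
       else if i < j then exp (fst e $ upper i i) * fst e $ upper i j else 0)" for i j :: 'a
    by (cases "i = j"; cases "i < j") (auto intro!: continuous_intros)
  then show ?thesis
    unfolding exp_coordinates_def by (intro continuous_intros)
qed

lemma continuous_on_log_coordinates: "continuous_on (carrier GN) log_coordinates"
proof -
  have pos: "fst x $ i $ i \<noteq> 0" "0 < fst x $ i $ i" if "x \<in> carrier GN" for x :: "'a mat_vec" and i
    using that by (auto simp: upper_triangular_pos_def less_le)
  have "continuous_on (carrier GN) (\<lambda>x::'a mat_vec. let i = fst (Rep_upper_index p); j = snd (Rep_upper_index p) in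
       if i = j then ln (fst x $ i $ i) else fst x $ i $ j / fst x $ i $ i)" for p
    unfolding Let_def
    by (cases "fst (Rep_upper_index p) = snd (Rep_upper_index p)")
      (use pos in \<open>auto intro!: continuous_intros simp del: GN_simps\<close>)
  moreover have "continuous_on (carrier GN) (\<lambda>x::'a mat_vec. snd x $ i / fst x $ i $ i)" for i
    using pos by (intro continuous_intros) blast
  ultimately show ?thesis
    unfolding log_coordinates_def by (intro continuous_on_Pair continuous_on_vec_lambda)
qed

lemma homeomorphic_maps_log_coordinates:
  "homeomorphic_maps GN_topology euclidean log_coordinates exp_coordinates"
  using exp_coordinates_in_GN exp_log_coordinates
  by (auto simp: homeomorphic_maps_def GN_topology_def continuous_map_in_subtopology
      continuous_on_exp_coordinates continuous_on_log_coordinates log_exp_coordinates simp del: GN_simps)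

text \<open>
  The measure \<open>GN_coordinates.lebesgue_of_space\<close> obtained here is the left Haar measure of the group.
\<close>

interpretation GN_coordinates: euclidean_coordinates GN_topology log_coordinates exp_coordinates
  by unfold_locales (rule homeomorphic_maps_log_coordinates)

text \<open>
  On basis vectors, the order in which left translations are triangular: the logarithms of the diagonal come
  first, with height \<open>0\<close>, and then the rows from the last to the first. The sums merely look up which
  coordinate a basis vector belongs to.
\<close>

definition coordinate_height :: "'n::{finite,linorder} chart_space \<Rightarrow> nat" where
  "coordinate_height b =
     (\<Sum>p\<in>UNIV. if fst b $ p = 0 \<or> fst (Rep_upper_index p) = snd (Rep_upper_index p) then 0
        else CARD('n) - position (fst (Rep_upper_index p))) +
     (\<Sum>i\<in>UNIV. if snd b $ i = 0 then 0 else CARD('n) - position i)"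

lemma coordinate_height_fst:
  fixes i j :: "'n::{finite,linorder}"
  shows "i \<le> j \<Longrightarrow> coordinate_height (axis (upper i j) 1, 0) = (if i = j then 0 else CARD('n) - position i)"
proof -
  assume "i \<le> j"
  have "(if axis (upper i j) (1::real) $ p = 0 \<or> fst (Rep_upper_index p) = snd (Rep_upper_index p) then 0
      else CARD('n) - position (fst (Rep_upper_index p))) =
    (if p = upper i j then if i = j then 0 else CARD('n) - position i else 0)" for p
    using \<open>i \<le> j\<close> by (auto simp: axis_def)
  then show ?thesis by (simp add: coordinate_height_def)
qed

lemma coordinate_height_snd:
  fixes i :: "'n::{finite,linorder}"
  shows "coordinate_height (0, axis i 1) = CARD('n) - position i"
proof -
  have "(if axis i (1::real) $ k = 0 then 0 else CARD('n) - position k) =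
    (if k = i then CARD('n) - position i else 0)" for k
    by (auto simp: axis_def)
  then show ?thesis by (simp add: coordinate_height_def)
qed

lemma continuous_map_left_mult:
  assumes "g \<in> carrier GN"
  shows "continuous_map GN_topology GN_topology (left_mult g)"
proof -
  have "continuous_on (carrier GN) (left_mult g)"
    unfolding GN_simps matrix_matrix_mult_def matrix_vector_mult_def
    by (intro continuous_intros)
  then show ?thesis
    unfolding GN_topology_def continuous_map_subtopology_eu
    using monoid.m_closed[OF group.is_monoid[OF group_GN] assms] by blast
qed

text \<open>
  The displacement of a coordinate in row \<open>i\<close> only involves rows below \<open>i\<close> and the logarithm of the \<open>i\<close>-th
  diagonal entry, because the summand for \<open>k = i\<close> in the matrix product gives back the coordinate itself.
\<close>

lemma left_mult_log_coordinates:
  fixes g :: "'n::{finite,linorder} mat_vec"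
  assumes g: "g \<in> carrier GN"
  defines "\<tau> \<equiv> log_coordinates \<circ> left_mult g \<circ> exp_coordinates"
  shows "fst (\<tau> e) $ upper i i = fst e $ upper i i + ln (fst g $ i $ i)"
    and "i < j \<Longrightarrow> fst (\<tau> e) $ upper i j = fst e $ upper i j +
      (\<Sum>k\<in>{i<..}. fst g $ i $ k * fst (exp_coordinates e) $ k $ j) / (fst g $ i $ i * exp (fst e $ upper i i))"
    and "snd (\<tau> e) $ i = snd e $ i +
      ((\<Sum>k\<in>{i<..}. fst g $ i $ k * snd (exp_coordinates e) $ k) + snd g $ i)
        / (fst g $ i $ i * exp (fst e $ upper i i))"
proof -
  have G: "upper_triangular_pos (fst g)" using g by simp
  then have pos: "0 < fst g $ i $ i" by (simp add: upper_triangular_pos_def)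
  have E: "upper_triangular_pos (fst (exp_coordinates e))"
    using exp_coordinates_in_GN[of e] by simp
  have diag: "(fst g ** fst (exp_coordinates e)) $ i $ i = fst g $ i $ i * exp (fst e $ upper i i)"
    by (simp add: upper_triangular_pos_mult_diagonal[OF G E])
  show "fst (\<tau> e) $ upper i i = fst e $ upper i i + ln (fst g $ i $ i)"
    using pos by (simp add: \<tau>_def diag ln_mult)
  show "fst (\<tau> e) $ upper i j = fst e $ upper i j +
      (\<Sum>k\<in>{i<..}. fst g $ i $ k * fst (exp_coordinates e) $ k $ j) / (fst g $ i $ i * exp (fst e $ upper i i))"
    if "i < j"
    using pos that by (simp add: \<tau>_def diag) (simp add: matrix_mult_entry upper_triangular_pos_sum_split[OF G] field_simps)
  show "snd (\<tau> e) $ i = snd e $ i +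
      ((\<Sum>k\<in>{i<..}. fst g $ i $ k * snd (exp_coordinates e) $ k) + snd g $ i)
        / (fst g $ i $ i * exp (fst e $ upper i i))"
    using pos upper_triangular_pos_sum_split[OF G, of i "($) (snd (exp_coordinates e))"]
    by (simp add: \<tau>_def diag matrix_vector_entry) (simp add: field_simps)
qed

lemma distr_lborel_left_mult:
  fixes g :: "'n::{finite,linorder} mat_vec"
  assumes g: "g \<in> carrier GN"
  shows "distr lborel borel (log_coordinates \<circ> left_mult g \<circ> exp_coordinates) = lborel"
proof (rule distr_lborel_triangular[where h = coordinate_height])
  let ?\<tau> = "log_coordinates \<circ> left_mult g \<circ> exp_coordinates"
  have "continuous_map euclidean euclidean ?\<tau>"
    using continuous_map_compose[OF GN_coordinates.continuous_\<psi>
        continuous_map_compose[OF continuous_map_left_mult[OF g] GN_coordinates.continuous_\<phi>]]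
    by (simp only: comp_assoc)
  then show "?\<tau> \<in> borel_measurable borel"
    by (simp add: borel_measurable_continuous_onI)
next
  let ?\<tau> = "log_coordinates \<circ> left_mult g \<circ> exp_coordinates"
  fix b x y :: "'n chart_space"
  assume b: "b \<in> Basis"
    and xy: "\<And>c. c \<in> Basis \<Longrightarrow> coordinate_height c < coordinate_height b \<Longrightarrow> x \<bullet> c = y \<bullet> c"
  have fst_eq: "fst x $ upper i j = fst y $ upper i j"
    if "i \<le> j" "(if i = j then 0 else CARD('n) - position i) < coordinate_height b" for i j
    using xy[of "(axis (upper i j) 1, 0)"] that
    by (simp add: coordinate_height_fst Basis_prod_def inner_prod_def inner_axis)
  have snd_eq: "snd x $ i = snd y $ i" if "CARD('n) - position i < coordinate_height b" for i
    using xy[of "(0, axis i 1)"] that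
    by (simp add: coordinate_height_snd Basis_prod_def inner_prod_def inner_axis)
  have exp_eq: "fst (exp_coordinates x) $ k $ j = fst (exp_coordinates y) $ k $ j"
    "snd (exp_coordinates x) $ k = snd (exp_coordinates y) $ k"
    if ht: "coordinate_height b = CARD('n) - position i" and "i < k" for i j k
  proof -
    have lt: "CARD('n) - position k < coordinate_height b"
      using position_strict_mono[OF that(2)] position_less[of k] ht by linarith
    then have "0 < coordinate_height b" by linarith
    then have d: "fst x $ upper l l = fst y $ upper l l" for l by (simp add: fst_eq)
    show "fst (exp_coordinates x) $ k $ j = fst (exp_coordinates y) $ k $ j"
      using d lt fst_eq[of k j] by (cases k j rule: linorder_cases) simp_all
    show "snd (exp_coordinates x) $ k = snd (exp_coordinates y) $ k"
      using d lt snd_eq[of k] by simp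
  qed
  have diag_eq: "fst x $ upper i i = fst y $ upper i i" if "coordinate_height b = CARD('n) - position i" for i
    using that position_less[of i] by (simp add: fst_eq)
  from b consider i j where "i \<le> j" "b = (axis (upper i j) 1, 0)" | i where "b = (0, axis i 1)"
    by (auto simp: Basis_prod_def Basis_vec_def) (metis upper_index_cases)
  then show "(?\<tau> x - x) \<bullet> b = (?\<tau> y - y) \<bullet> b"
  proof cases
    case (1 i j)
    show ?thesis
    proof (cases "i = j")
      case True
      then show ?thesis
        using 1 by (simp add: inner_prod_def inner_axis left_mult_log_coordinates(1)[OF g] del: o_apply GN_simps)
    next
      case False
      with 1 have ij: "i < j" and ht: "coordinate_height b = CARD('n) - position i"
        by (simp_all add: coordinate_height_fst)
      have "(\<Sum>k\<in>{i<..}. fst g $ i $ k * fst (exp_coordinates x) $ k $ j) =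
          (\<Sum>k\<in>{i<..}. fst g $ i $ k * fst (exp_coordinates y) $ k $ j)"
        by (rule sum.cong) (simp_all add: exp_eq[OF ht])
      then show ?thesis
        using 1 ij diag_eq[OF ht]
        by (simp add: inner_prod_def inner_axis left_mult_log_coordinates(2)[OF g] del: o_apply GN_simps)
    qed
  next
    case (2 i)
    then have ht: "coordinate_height b = CARD('n) - position i"
      by (simp add: coordinate_height_snd)
    have "(\<Sum>k\<in>{i<..}. fst g $ i $ k * snd (exp_coordinates x) $ k) =
        (\<Sum>k\<in>{i<..}. fst g $ i $ k * snd (exp_coordinates y) $ k)"
      by (rule sum.cong) (simp_all only: exp_eq[OF ht] greaterThan_iff)
    then show ?thesis
      using 2 diag_eq[OF ht]
      by (simp add: inner_prod_def inner_axis left_mult_log_coordinates(3)[OF g] del: o_apply GN_simps)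
  qed
qed

abbreviation GN_haar :: "'n::{finite,linorder} mat_vec measure" where
  "GN_haar \<equiv> GN_coordinates.lebesgue_of_space"

lemma topspace_GN [simp]: "topspace GN_topology = carrier GN"
  by (simp add: GN_topology_def)

lemma distr_GN_haar_left_mult: "g \<in> carrier GN \<Longrightarrow> distr GN_haar GN_haar (left_mult g) = GN_haar"
  by (intro GN_coordinates.distr_lebesgue_of_space continuous_map_left_mult distr_lborel_left_mult)

lemma measurable_left_mult: "g \<in> carrier GN \<Longrightarrow> left_mult g \<in> measurable GN_haar GN_haar"
  using GN_coordinates.measurable_continuous_map[OF continuous_map_left_mult]
  by (simp cong: measurable_cong_sets del: GN_simps)

text \<open>
  The image of a set under left translation by \<open>g\<close> is its preimage under translation by the inverse of \<open>g\<close>,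
  so invariance of the measure under pushforward suffices.
\<close>

lemma left_Haar_measure_GN:
  "left_Haar_measure GN GN_topology (GN_haar :: 'n::{finite,linorder} mat_vec measure)"
proof -
  interpret group "GN :: 'n mat_vec monoid" by (rule group_GN)
  have "emeasure GN_haar (left_mult g ` B) = emeasure GN_haar B"
    if g: "g \<in> carrier GN" and B: "B \<in> sets GN_haar" for g and B :: "'n mat_vec set"
  proof -
    let ?h = "inv\<^bsub>GN\<^esub> g"
    have h: "?h \<in> carrier GN" using g by (rule inv_closed)
    have BG: "B \<subseteq> carrier GN" using sets.sets_into_space[OF B] by (simp del: GN_simps)
    have "left_mult g ` B = left_mult ?h -` B \<inter> carrier GN"
    proof
      show "left_mult g ` B \<subseteq> left_mult ?h -` B \<inter> carrier GN"
        using BG g h by (auto simp: m_assoc[symmetric] l_inv simp del: GN_simps)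
      show "left_mult ?h -` B \<inter> carrier GN \<subseteq> left_mult g ` B"
      proof
        fix x assume "x \<in> left_mult ?h -` B \<inter> carrier GN"
        then have "left_mult ?h x \<in> B" "x = left_mult g (left_mult ?h x)"
          using g h by (auto simp: m_assoc[symmetric] r_inv simp del: GN_simps)
        then show "x \<in> left_mult g ` B" by blast
      qed
    qed
    moreover have "emeasure GN_haar B = emeasure (distr GN_haar GN_haar (left_mult ?h)) B"
      by (simp only: distr_GN_haar_left_mult[OF h])
    moreover have "\<dots> = emeasure GN_haar (left_mult ?h -` B \<inter> carrier GN)"
      using B by (subst emeasure_distr[OF measurable_left_mult[OF h]]) (simp_all del: GN_simps)
    ultimately show ?thesis by simp
  qed
  then show ?thesis
    unfolding left_Haar_measure_def
    by (intro conjI allI ballI impI GN_coordinates.lebesgue_of_space_nonzero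
        GN_coordinates.lebesgue_of_space_compact GN_coordinates.lebesgue_of_space_outer_regular
        GN_coordinates.lebesgue_of_space_inner_regular)
      (simp_all only: GN_coordinates.space_lebesgue_of_space GN_coordinates.sets_lebesgue_of_space
        GN_coordinates.sets_borel_of_space)
qed


section \<open>Amenability\<close>

lemma loc_AE_left_mult:
  assumes g: "g \<in> carrier GN" and Q: "loc_AE GN_topology GN_haar Q"
  shows "loc_AE GN_topology GN_haar (\<lambda>x. Q (left_mult g x))"
proof -
  from Q have "AE x in distr GN_haar GN_haar (left_mult g). Q x"
    by (simp only: distr_GN_haar_left_mult[OF g] GN_coordinates.loc_AE_iff_AE)
  then show ?thesis
    unfolding GN_coordinates.loc_AE_iff_AE by (rule AE_distrD[OF measurable_left_mult[OF g]])
qed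

text \<open>
  Left translations act on \<open>L\<^sup>\<infinity>\<close> and preserve its positive cone because Haar measure is invariant, so the
  solvability argument applies to \<open>L\<^sup>\<infinity>\<close> itself.
\<close>

lemma left_invariant_mean_GN:
  "\<exists>M. left_invariant_mean GN GN_topology (GN_haar :: 'n::{finite,linorder} mat_vec measure) M"
proof -
  let ?V = "Linfty GN_topology (GN_haar :: 'n mat_vec measure)"
  let ?P = "\<lambda>f. loc_AE GN_topology (GN_haar :: 'n mat_vec measure) (\<lambda>x. 0 \<le> (f x :: real))"
  obtain M0 where "mean_on ?V ?P M0"
    using GN_coordinates.mean_on_Linfty_exists by blast
  then have "\<exists>M. mean_on ?V ?P M \<and> invariant_under ?V (left_mult ` carrier GN) M"
  proof (rule GN_invariant_mean_exists[OF GN_coordinates.order_unit_Linfty, rotated 2])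
    fix g f assume g: "g \<in> carrier (GN :: 'n mat_vec monoid)" and f: "f \<in> ?V"
    then obtain C where "f \<in> borel_measurable GN_haar" "loc_AE GN_topology GN_haar (\<lambda>x. \<bar>f x\<bar> \<le> C)"
      by (auto simp: Linfty_def)
    then have "f \<circ> left_mult g \<in> borel_measurable GN_haar"
      "loc_AE GN_topology GN_haar (\<lambda>x. \<bar>(f \<circ> left_mult g) x\<bar> \<le> C)"
      using measurable_comp[OF measurable_left_mult[OF g]] loc_AE_left_mult[OF g] by (simp_all add: comp_def)
    then show "f \<circ> left_mult g \<in> ?V" unfolding Linfty_def by blast
  next
    fix g f assume "g \<in> carrier (GN :: 'n mat_vec monoid)" "?P f"
    then show "?P (f \<circ> left_mult g)" using loc_AE_left_mult[of g "\<lambda>x. 0 \<le> f x"] by (simp add: comp_def)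
  qed
  then obtain M where "mean_on ?V ?P M" "invariant_under ?V (left_mult ` carrier GN) M"
    by blast
  then have "left_invariant_mean GN GN_topology (GN_haar :: 'n mat_vec measure) M"
    unfolding left_invariant_mean_def mean_on_Linfty_def mean_on_def invariant_under_def comp_def
    by blast
  then show ?thesis by blast
qed

lemma locally_compact_group_GN: "locally_compact_group (GN :: 'n::{finite,linorder} mat_vec monoid) GN_topology"
proof -
  have "(GN_topology :: 'n mat_vec topology) homeomorphic_space (euclidean :: 'n chart_space topology)"
    using homeomorphic_maps_log_coordinates[where ?'a = 'n]
    unfolding homeomorphic_space_def by (intro exI)
  then have "locally_compact_space (GN_topology :: 'n mat_vec topology)"
    using homeomorphic_locally_compact_space locally_compact_space_euclidean by blast
  then show ?thesis
    using lie_group_GN[where ?'n = 'n]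
    unfolding lie_group_def smooth_manifold_def smooth_map_def locally_compact_group_def topological_group_def
    by blast
qed

theorem amenable_group_GN: "amenable_group (GN :: 'n::{finite,linorder} mat_vec monoid) GN_topology"
  unfolding amenable_group_def
  using locally_compact_group_GN left_Haar_measure_GN left_invariant_mean_GN by blast

theorem proposition1p3:
  shows "lie_group (GN :: 'n::{finite,linorder} mat_vec monoid) GN_topology GN_atlas
       \<and> amenable_group (GN :: 'n::{finite,linorder} mat_vec monoid) GN_topology"
  using lie_group_GN amenable_group_GN by (rule conjI)

end
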